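(* Let $H$ be a quasitriangular Hopf algebra over a field $k$ and let $C,B$ be dually paired Hopf algebras in the braided monoidal category of left $H$-modules. Then the algebra $\mathrm{Heis}_H(C,B)$ is a right cocycle twist of the Hopf algebra $\mathrm{Drin}_H(C,B)$ via the right 2-cocycle given by $$\sigma(chb\otimes c'h'b')=\varepsilon(c)\,\varepsilon(h)\,\mathrm{ev}(S^{-1}(c')\otimes b)\,\varepsilon(h')\,\varepsilon(b'),\qquad c,c'\in C,\ h,h'\in H,\ b,b'\in B.$$ That is, $\sigma$ is a right 2-cocycle on $\mathrm{Drin}_H(C,B)$ and $\mathrm{Heis}_H(C,B)=\mathrm{Drin}_H(C,B)_\sigma$ (identifying both underlying vector spaces with $C\otimes H\otimes B$).
   Context: Let $R=R^{(1)}\otimes R^{(2)}$ be the universal R-matrix of $H$. The category of left $H$-modules is braided with $\Psi(v\otimes w)=(R^{(2)}\triangleright w)\otimes (R^{(1)}\triangleright v)$. Sweedler notation $\Delta(x)=x_{(1)}\otimes x_{(2)}$ is used for the coproducts of $H$, $B$, $C$ (for $B$, $C$ these are the braided coproducts in the category of $H$-modules). Dually paired Hopf algebras: $C,B$ are Hopf algebras in the category of left $H$-modules with invertible antipodes and an $H$-linear map $\mathrm{ev}\colon C\otimes B\to k$ such that $\mathrm{ev}(cc'\otimes b)=\mathrm{ev}(c'\otimes b_{(1)})\mathrm{ev}(c\otimes b_{(2)})$, $\mathrm{ev}(c\otimes bb')=\mathrm{ev}(c_{(2)}\otimes b)\mathrm{ev}(c_{(1)}\otimes b')$, $\mathrm{ev}(1\otimes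 b)=\varepsilon(b)$, $\mathrm{ev}(c\otimes 1)=\varepsilon(c)$, and $\mathrm{ev}(S(c)\otimes b)=\mathrm{ev}(c\otimes S(b))$. In the formula for $\sigma$, $S^{-1}$ is the inverse of the braided antipode of $C$. Braided doubles: both $\mathrm{Drin}_H(C,B)$ and $\mathrm{Heis}_H(C,B)$ are algebras on the vector space $C\otimes H\otimes B$, where $c\otimes h\otimes b$ is written $chb$ and is the product of $c$, $h$, $b$. Both contain $C$, $H$ and $B^{\mathrm{op}}$ (ordinary opposite product) as subalgebras and satisfy the bosonization relations $$hc=(h_{(1)}\triangleright c)h_{(2)},\qquad hb=(h_{(2)}\triangleright b)h_{(1)}.$$ In $\mathrm{Drin}_H(C,B)$ the cross relation is $$b_{(2)}R^{(1)}c_{(2)}\,\mathrm{ev}(c_{(1)}\otimes (R^{(2)}\triangleright b_{(1)}))= c_{(1)}R^{(2)}b_{(1)}\,\mathrm{ev}((R^{(1)}\triangleright c_{(2)})\otimes b_{(2)}),$$ and in $\mathrm{Heis}_H(C,B)$ it is $$cb=b_{(2)}R^{(1)}c_{(2)}\,\mathrm{ev}(c_{(1)}\otimes (R^{(2)}\triangleright b_{(1)})).$$ (Equivalently, these are the algebras reconstructed on $C\otimes H\otimes B$ from the categories of left $C$-, right $B$-modules in the category of $H$-modules satisfying the Yetter–Drinfeld, respectively Hopf, compatibility condition, $chb$ acting by $v\mapsto c\triangleright(h\triangleright(v\triangleleft b))$.) $\mathrm{Drin}_H(C,B)$ is a Hopf algebra over $k$ with coproduct $$\Delta(h)=h_{(1)}\otimes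 h_{(2)},\quad \Delta(b)=(R^{(2)}\triangleright b_{(1)})\otimes b_{(2)}R^{(1)},\quad \Delta(c)=c_{(1)}R^{(2)}\otimes (R^{(1)}\triangleright c_{(2)})$$ and counit $\varepsilon(chb)=\varepsilon(c)\varepsilon(h)\varepsilon(b)$. Right cocycle twist: for a bialgebra $D$ over $k$, a right 2-cocycle is a linear map $\sigma\colon D\otimes D\to k$ such that $m_\sigma(x\otimes y)=x_{(1)}y_{(1)}\sigma(x_{(2)}\otimes y_{(2)})$ gives $D$ an algebra structure; the resulting algebra $D_\sigma$ is the right cocycle twist of $D$ by $\sigma$. *)

theory Defs
  imports Complex_Main
begin

section \<open>Multilinear maps and tensors\<close>

definition bilinear_map ::
  "('k::field \<Rightarrow> 'v::ab_group_add \<Rightarrow> 'v) \<Rightarrow> ('k \<Rightarrow> 'w::ab_group_add \<Rightarrow> 'w) \<Rightarrow>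
   ('k \<Rightarrow> 'x::ab_group_add \<Rightarrow> 'x) \<Rightarrow> ('v \<Rightarrow> 'w \<Rightarrow> 'x) \<Rightarrow> bool" where
  "bilinear_map sV sW sX f \<longleftrightarrow>
     (\<forall>w. Vector_Spaces.linear sV sX (\<lambda>v. f v w)) \<and>
     (\<forall>v. Vector_Spaces.linear sW sX (\<lambda>w. f v w))"

definition trilinear_map ::
  "('k::field \<Rightarrow> 'u::ab_group_add \<Rightarrow> 'u) \<Rightarrow> ('k \<Rightarrow> 'v::ab_group_add \<Rightarrow> 'v) \<Rightarrow>
   ('k \<Rightarrow> 'w::ab_group_add \<Rightarrow> 'w) \<Rightarrow> ('k \<Rightarrow> 'x::ab_group_add \<Rightarrow> 'x) \<Rightarrow>
   ('u \<Rightarrow> 'v \<Rightarrow> 'w \<Rightarrow> 'x) \<Rightarrow> bool" where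
  "trilinear_map sU sV sW sX f \<longleftrightarrow>
     (\<forall>v w. Vector_Spaces.linear sU sX (\<lambda>u. f u v w)) \<and>
     (\<forall>u w. Vector_Spaces.linear sV sX (\<lambda>v. f u v w)) \<and>
     (\<forall>u v. Vector_Spaces.linear sW sX (\<lambda>w. f u v w))"

text \<open>
  An element of \<open>V \<otimes> W\<close> is written as a finite formal sum of elementary tensors, that is, as a list
  of pairs: \<open>[(v1, w1), ..., (vn, wn)]\<close> stands for \<open>v1 \<otimes> w1 + ... + vn \<otimes> wn\<close>. Two lists denote
  the same tensor iff they are related by the following congruence, so that \<open>V \<otimes> W\<close> is the set of
  lists modulo \<open>tensor2_eq\<close>. Sweedler notation then becomes a list comprehension or a
  \<open>sum_list\<close>. The same is done for threefold tensor products.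
\<close>

inductive tensor2_eq ::
  "('k::field \<Rightarrow> 'v::ab_group_add \<Rightarrow> 'v) \<Rightarrow> ('k \<Rightarrow> 'w::ab_group_add \<Rightarrow> 'w) \<Rightarrow>
   ('v \<times> 'w) list \<Rightarrow> ('v \<times> 'w) list \<Rightarrow> bool"
  for sV sW where
  refl: "tensor2_eq sV sW s s"
| sym: "tensor2_eq sV sW s t \<Longrightarrow> tensor2_eq sV sW t s"
| trans: "tensor2_eq sV sW s t \<Longrightarrow> tensor2_eq sV sW t r \<Longrightarrow> tensor2_eq sV sW s r"
| append: "tensor2_eq sV sW s s' \<Longrightarrow> tensor2_eq sV sW t t' \<Longrightarrow> tensor2_eq sV sW (s @ t) (s' @ t')"
| commute: "tensor2_eq sV sW (s @ t) (t @ s)"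
| zero: "tensor2_eq sV sW [(0, 0)] []"
| add_left: "tensor2_eq sV sW [(v + v', w)] [(v, w), (v', w)]"
| add_right: "tensor2_eq sV sW [(v, w + w')] [(v, w), (v, w')]"
| balance: "tensor2_eq sV sW [(sV a v, w)] [(v, sW a w)]"

inductive tensor3_eq ::
  "('k::field \<Rightarrow> 'u::ab_group_add \<Rightarrow> 'u) \<Rightarrow> ('k \<Rightarrow> 'v::ab_group_add \<Rightarrow> 'v) \<Rightarrow>
   ('k \<Rightarrow> 'w::ab_group_add \<Rightarrow> 'w) \<Rightarrow>
   ('u \<times> 'v \<times> 'w) list \<Rightarrow> ('u \<times> 'v \<times> 'w) list \<Rightarrow> bool"
  for sU sV sW where
  refl: "tensor3_eq sU sV sW s s"
| sym: "tensor3_eq sU sV sW s t \<Longrightarrow> tensor3_eq sU sV sW t s"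
| trans: "tensor3_eq sU sV sW s t \<Longrightarrow> tensor3_eq sU sV sW t r \<Longrightarrow> tensor3_eq sU sV sW s r"
| append: "tensor3_eq sU sV sW s s' \<Longrightarrow> tensor3_eq sU sV sW t t' \<Longrightarrow>
           tensor3_eq sU sV sW (s @ t) (s' @ t')"
| commute: "tensor3_eq sU sV sW (s @ t) (t @ s)"
| zero: "tensor3_eq sU sV sW [(0, 0, 0)] []"
| add_1: "tensor3_eq sU sV sW [(u + u', v, w)] [(u, v, w), (u', v, w)]"
| add_2: "tensor3_eq sU sV sW [(u, v + v', w)] [(u, v, w), (u, v', w)]"
| add_3: "tensor3_eq sU sV sW [(u, v, w + w')] [(u, v, w), (u, v, w')]"
| balance_12: "tensor3_eq sU sV sW [(sU a u, v, w)] [(u, sV a v, w)]"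
| balance_23: "tensor3_eq sU sV sW [(u, sV a v, w)] [(u, v, sW a w)]"

text \<open>A linear map \<open>X \<rightarrow> V \<otimes> W\<close>, given by a choice of representing formal sums.\<close>

definition linear_to_tensor2 ::
  "('k::field \<Rightarrow> 'x::ab_group_add \<Rightarrow> 'x) \<Rightarrow> ('k \<Rightarrow> 'v::ab_group_add \<Rightarrow> 'v) \<Rightarrow>
   ('k \<Rightarrow> 'w::ab_group_add \<Rightarrow> 'w) \<Rightarrow> ('x \<Rightarrow> ('v \<times> 'w) list) \<Rightarrow> bool" where
  "linear_to_tensor2 sX sV sW f \<longleftrightarrow>
     (\<forall>x y. tensor2_eq sV sW (f (x + y)) (f x @ f y)) \<and>
     (\<forall>a x. tensor2_eq sV sW (f (sX a x)) [(sV a v, w). (v, w) \<leftarrow> f x])"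

text \<open>The vector space \<open>X\<close> together with \<open>\<tau>\<close> is the tensor product \<open>U \<otimes> V \<otimes> W\<close>, where
  \<open>\<tau> u v w\<close> is \<open>u \<otimes> v \<otimes> w\<close>.\<close>

definition is_tensor_product3 ::
  "('k::field \<Rightarrow> 'u::ab_group_add \<Rightarrow> 'u) \<Rightarrow> ('k \<Rightarrow> 'v::ab_group_add \<Rightarrow> 'v) \<Rightarrow>
   ('k \<Rightarrow> 'w::ab_group_add \<Rightarrow> 'w) \<Rightarrow> ('k \<Rightarrow> 'x::ab_group_add \<Rightarrow> 'x) \<Rightarrow>
   ('u \<Rightarrow> 'v \<Rightarrow> 'w \<Rightarrow> 'x) \<Rightarrow> bool" where
  "is_tensor_product3 sU sV sW sX \<tau> \<longleftrightarrow>
     trilinear_map sU sV sW sX \<tau> \<and>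
     (\<forall>x. \<exists>s. x = (\<Sum>(u, v, w)\<leftarrow>s. \<tau> u v w)) \<and>
     (\<forall>s t. (\<Sum>(u, v, w)\<leftarrow>s. \<tau> u v w) = (\<Sum>(u, v, w)\<leftarrow>t. \<tau> u v w) \<longrightarrow> tensor3_eq sU sV sW s t)"


section \<open>Algebras, coalgebras and Hopf algebras over a field\<close>

record ('k, 'a) alg_data =
  scl :: "'k \<Rightarrow> 'a \<Rightarrow> 'a"
  mul :: "'a \<Rightarrow> 'a \<Rightarrow> 'a"
  one :: "'a"

record ('k, 'a) hopf_data = "('k, 'a) alg_data" +
  comul :: "'a \<Rightarrow> ('a \<times> 'a) list"
  counit :: "'a \<Rightarrow> 'k"
  antipode :: "'a \<Rightarrow> 'a"

abbreviation mul_in :: "'a \<Rightarrow> ('k, 'a, 'm) alg_data_scheme \<Rightarrow> 'a \<Rightarrow> 'a"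
    (\<open>(_ \<cdot>\<^bsub>_\<^esub>/ _)\<close> [70, 0, 71] 70) where
  "x \<cdot>\<^bsub>A\<^esub> y \<equiv> mul A x y"

definition k_algebra :: "('k::field, 'a::ab_group_add, 'm) alg_data_scheme \<Rightarrow> bool" where
  "k_algebra A \<longleftrightarrow>
     vector_space (scl A) \<and>
     bilinear_map (scl A) (scl A) (scl A) (mul A) \<and>
     (\<forall>x y z. (x \<cdot>\<^bsub>A\<^esub> y) \<cdot>\<^bsub>A\<^esub> z = x \<cdot>\<^bsub>A\<^esub> (y \<cdot>\<^bsub>A\<^esub> z)) \<and>
     (\<forall>x. one A \<cdot>\<^bsub>A\<^esub> x = x \<and> x \<cdot>\<^bsub>A\<^esub> one A = x)"

definition k_coalgebra :: "('k::field, 'a::ab_group_add) hopf_data \<Rightarrow> bool" where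
  "k_coalgebra A \<longleftrightarrow>
     vector_space (scl A) \<and>
     linear_to_tensor2 (scl A) (scl A) (scl A) (comul A) \<and>
     Vector_Spaces.linear (scl A) (*) (counit A) \<and>
     (\<forall>x. tensor3_eq (scl A) (scl A) (scl A)
            [(x11, x12, x2). (x1, x2) \<leftarrow> comul A x, (x11, x12) \<leftarrow> comul A x1]
            [(x1, x21, x22). (x1, x2) \<leftarrow> comul A x, (x21, x22) \<leftarrow> comul A x2]) \<and>
     (\<forall>x. (\<Sum>(x1, x2)\<leftarrow>comul A x. scl A (counit A x1) x2) = x) \<and>
     (\<forall>x. (\<Sum>(x1, x2)\<leftarrow>comul A x. scl A (counit A x2) x1) = x)"

definition is_antipode :: "('k::field, 'a::ab_group_add) hopf_data \<Rightarrow> bool" where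
  "is_antipode A \<longleftrightarrow>
     Vector_Spaces.linear (scl A) (scl A) (antipode A) \<and>
     (\<forall>x. (\<Sum>(x1, x2)\<leftarrow>comul A x. antipode A x1 \<cdot>\<^bsub>A\<^esub> x2) = scl A (counit A x) (one A)) \<and>
     (\<forall>x. (\<Sum>(x1, x2)\<leftarrow>comul A x. x1 \<cdot>\<^bsub>A\<^esub> antipode A x2) = scl A (counit A x) (one A))"

definition counit_multiplicative :: "('k::field, 'a::ab_group_add) hopf_data \<Rightarrow> bool" where
  "counit_multiplicative A \<longleftrightarrow>
     (\<forall>x y. counit A (x \<cdot>\<^bsub>A\<^esub> y) = counit A x * counit A y) \<and> counit A (one A) = 1"

definition hopf_algebra :: "('k::field, 'a::ab_group_add) hopf_data \<Rightarrow> bool" where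
  "hopf_algebra A \<longleftrightarrow>
     k_algebra A \<and> k_coalgebra A \<and> counit_multiplicative A \<and>
     (\<forall>x y. tensor2_eq (scl A) (scl A) (comul A (x \<cdot>\<^bsub>A\<^esub> y))
              [(x1 \<cdot>\<^bsub>A\<^esub> y1, x2 \<cdot>\<^bsub>A\<^esub> y2). (x1, x2) \<leftarrow> comul A x, (y1, y2) \<leftarrow> comul A y]) \<and>
     tensor2_eq (scl A) (scl A) (comul A (one A)) [(one A, one A)] \<and>
     is_antipode A"

text \<open>
  \<open>R\<close> is a formal sum for the universal R-matrix. The axioms are: \<open>R\<close> is invertible,
  \<open>(\<Delta> \<otimes> id) R = R13 R23\<close>, \<open>(id \<otimes> \<Delta>) R = R13 R12\<close>, and \<open>\<Delta>\<^sup>o\<^sup>p(h) R = R \<Delta>(h)\<close>.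
\<close>

definition quasitriangular_hopf_algebra ::
  "('k::field, 'h::ab_group_add) hopf_data \<Rightarrow> ('h \<times> 'h) list \<Rightarrow> bool" where
  "quasitriangular_hopf_algebra H R \<longleftrightarrow>
     hopf_algebra H \<and>
     (\<exists>Q. tensor2_eq (scl H) (scl H)
            [(r1 \<cdot>\<^bsub>H\<^esub> q1, r2 \<cdot>\<^bsub>H\<^esub> q2). (r1, r2) \<leftarrow> R, (q1, q2) \<leftarrow> Q] [(one H, one H)] \<and>
          tensor2_eq (scl H) (scl H)
            [(q1 \<cdot>\<^bsub>H\<^esub> r1, q2 \<cdot>\<^bsub>H\<^esub> r2). (q1, q2) \<leftarrow> Q, (r1, r2) \<leftarrow> R] [(one H, one H)]) \<and>
     tensor3_eq (scl H) (scl H) (scl H)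
       [(r11, r12, r2). (r1, r2) \<leftarrow> R, (r11, r12) \<leftarrow> comul H r1]
       [(r1, r1', r2 \<cdot>\<^bsub>H\<^esub> r2'). (r1, r2) \<leftarrow> R, (r1', r2') \<leftarrow> R] \<and>
     tensor3_eq (scl H) (scl H) (scl H)
       [(r1, r21, r22). (r1, r2) \<leftarrow> R, (r21, r22) \<leftarrow> comul H r2]
       [(r1 \<cdot>\<^bsub>H\<^esub> r1', r2', r2). (r1, r2) \<leftarrow> R, (r1', r2') \<leftarrow> R] \<and>
     (\<forall>h. tensor2_eq (scl H) (scl H)
            [(h2 \<cdot>\<^bsub>H\<^esub> r1, h1 \<cdot>\<^bsub>H\<^esub> r2). (h1, h2) \<leftarrow> comul H h, (r1, r2) \<leftarrow> R]
            [(r1 \<cdot>\<^bsub>H\<^esub> h1, r2 \<cdot>\<^bsub>H\<^esub> h2). (r1, r2) \<leftarrow> R, (h1, h2) \<leftarrow> comul H h])"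


section \<open>Hopf algebras in the braided category of left modules\<close>

definition left_module ::
  "('k::field, 'h::ab_group_add) hopf_data \<Rightarrow> ('k \<Rightarrow> 'v::ab_group_add \<Rightarrow> 'v) \<Rightarrow>
   ('h \<Rightarrow> 'v \<Rightarrow> 'v) \<Rightarrow> bool" where
  "left_module H sV act \<longleftrightarrow>
     bilinear_map (scl H) sV sV act \<and>
     (\<forall>v. act (one H) v = v) \<and>
     (\<forall>g h v. act (g \<cdot>\<^bsub>H\<^esub> h) v = act g (act h v))"

text \<open>
  All structure maps of \<open>B\<close> are \<open>H\<close>-linear, and the coproduct is multiplicative for the product
  \<open>(a \<otimes> b) (a' \<otimes> b') = a (R\<^sup>(\<^sup>2\<^sup>) \<triangleright> a') \<otimes> (R\<^sup>(\<^sup>1\<^sup>) \<triangleright> b) b'\<close> on \<open>B \<otimes> B\<close> induced by the braiding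
  \<open>v \<otimes> w \<mapsto> (R\<^sup>(\<^sup>2\<^sup>) \<triangleright> w) \<otimes> (R\<^sup>(\<^sup>1\<^sup>) \<triangleright> v)\<close>.
\<close>

definition braided_hopf_algebra ::
  "('k::field, 'h::ab_group_add) hopf_data \<Rightarrow> ('h \<times> 'h) list \<Rightarrow>
   ('k, 'b::ab_group_add) hopf_data \<Rightarrow> ('h \<Rightarrow> 'b \<Rightarrow> 'b) \<Rightarrow> bool" where
  "braided_hopf_algebra H R B act \<longleftrightarrow>
     left_module H (scl B) act \<and>
     k_algebra B \<and> k_coalgebra B \<and> counit_multiplicative B \<and> is_antipode B \<and>
     (\<forall>h x y. act h (x \<cdot>\<^bsub>B\<^esub> y) = (\<Sum>(h1, h2)\<leftarrow>comul H h. act h1 x \<cdot>\<^bsub>B\<^esub> act h2 y)) \<and>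
     (\<forall>h. act h (one B) = scl B (counit H h) (one B)) \<and>
     (\<forall>h x. tensor2_eq (scl B) (scl B) (comul B (act h x))
              [(act h1 x1, act h2 x2). (h1, h2) \<leftarrow> comul H h, (x1, x2) \<leftarrow> comul B x]) \<and>
     (\<forall>h x. counit B (act h x) = counit H h * counit B x) \<and>
     (\<forall>h x. antipode B (act h x) = act h (antipode B x)) \<and>
     (\<forall>x y. tensor2_eq (scl B) (scl B) (comul B (x \<cdot>\<^bsub>B\<^esub> y))
              [(x1 \<cdot>\<^bsub>B\<^esub> act r2 y1, act r1 x2 \<cdot>\<^bsub>B\<^esub> y2).
                 (x1, x2) \<leftarrow> comul B x, (y1, y2) \<leftarrow> comul B y, (r1, r2) \<leftarrow> R]) \<and>
     tensor2_eq (scl B) (scl B) (comul B (one B)) [(one B, one B)]"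

definition dually_paired ::
  "('k::field, 'h::ab_group_add) hopf_data \<Rightarrow> ('h \<times> 'h) list \<Rightarrow>
   ('k, 'c::ab_group_add) hopf_data \<Rightarrow> ('h \<Rightarrow> 'c \<Rightarrow> 'c) \<Rightarrow>
   ('k, 'b::ab_group_add) hopf_data \<Rightarrow> ('h \<Rightarrow> 'b \<Rightarrow> 'b) \<Rightarrow> ('c \<Rightarrow> 'b \<Rightarrow> 'k) \<Rightarrow> bool" where
  "dually_paired H R C actC B actB ev \<longleftrightarrow>
     braided_hopf_algebra H R C actC \<and> bij (antipode C) \<and>
     braided_hopf_algebra H R B actB \<and> bij (antipode B) \<and>
     bilinear_map (scl C) (scl B) (*) ev \<and>
     (\<forall>h c b. (\<Sum>(h1, h2)\<leftarrow>comul H h. ev (actC h1 c) (actB h2 b)) = counit H h * ev c b) \<and>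
     (\<forall>c c' b. ev (c \<cdot>\<^bsub>C\<^esub> c') b = (\<Sum>(b1, b2)\<leftarrow>comul B b. ev c' b1 * ev c b2)) \<and>
     (\<forall>c b b'. ev c (b \<cdot>\<^bsub>B\<^esub> b') = (\<Sum>(c1, c2)\<leftarrow>comul C c. ev c2 b * ev c1 b')) \<and>
     (\<forall>b. ev (one C) b = counit B b) \<and>
     (\<forall>c. ev c (one B) = counit C c) \<and>
     (\<forall>c b. ev (antipode C c) b = ev c (antipode B b))"


section \<open>Braided doubles\<close>

text \<open>
  \<open>D\<close> is an algebra on \<open>C \<otimes> H \<otimes> B\<close>, with \<open>\<tau> c h b = c \<otimes> h \<otimes> b = chb\<close>, containing \<open>C\<close>, \<open>H\<close>
  and \<open>B\<^sup>o\<^sup>p\<close> as subalgebras and satisfying the bosonization relations.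
\<close>

definition bosonized_algebra ::
  "('k::field, 'h::ab_group_add) hopf_data \<Rightarrow>
   ('k, 'c::ab_group_add) hopf_data \<Rightarrow> ('h \<Rightarrow> 'c \<Rightarrow> 'c) \<Rightarrow>
   ('k, 'b::ab_group_add) hopf_data \<Rightarrow> ('h \<Rightarrow> 'b \<Rightarrow> 'b) \<Rightarrow>
   ('k, 'd::ab_group_add, 'm) alg_data_scheme \<Rightarrow> ('c \<Rightarrow> 'h \<Rightarrow> 'b \<Rightarrow> 'd) \<Rightarrow> bool" where
  "bosonized_algebra H C actC B actB D \<tau> \<longleftrightarrow>
     (let inC = (\<lambda>c. \<tau> c (one H) (one B));
          inH = (\<lambda>h. \<tau> (one C) h (one B));
          inB = (\<lambda>b. \<tau> (one C) (one H) b)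
      in k_algebra D \<and>
         is_tensor_product3 (scl C) (scl H) (scl B) (scl D) \<tau> \<and>
         one D = \<tau> (one C) (one H) (one B) \<and>
         (\<forall>c h b. \<tau> c h b = inC c \<cdot>\<^bsub>D\<^esub> inH h \<cdot>\<^bsub>D\<^esub> inB b) \<and>
         (\<forall>c c'. inC c \<cdot>\<^bsub>D\<^esub> inC c' = inC (c \<cdot>\<^bsub>C\<^esub> c')) \<and>
         (\<forall>h h'. inH h \<cdot>\<^bsub>D\<^esub> inH h' = inH (h \<cdot>\<^bsub>H\<^esub> h')) \<and>
         (\<forall>b b'. inB b \<cdot>\<^bsub>D\<^esub> inB b' = inB (b' \<cdot>\<^bsub>B\<^esub> b)) \<and>
         (\<forall>h c. inH h \<cdot>\<^bsub>D\<^esub> inC c = (\<Sum>(h1, h2)\<leftarrow>comul H h. inC (actC h1 c) \<cdot>\<^bsub>D\<^esub> inH h2)) \<and>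
         (\<forall>h b. inH h \<cdot>\<^bsub>D\<^esub> inB b = (\<Sum>(h1, h2)\<leftarrow>comul H h. inB (actB h2 b) \<cdot>\<^bsub>D\<^esub> inH h1)))"

text \<open>
  The cross relations determine the products \<open>bc\<close> because \<open>ev\<close> is convolution invertible. So the
  next two predicates characterize the algebras Heis and Drin on \<open>C \<otimes> H \<otimes> B\<close> uniquely.
\<close>

definition is_Heis ::
  "('k::field, 'h::ab_group_add) hopf_data \<Rightarrow> ('h \<times> 'h) list \<Rightarrow>
   ('k, 'c::ab_group_add) hopf_data \<Rightarrow> ('h \<Rightarrow> 'c \<Rightarrow> 'c) \<Rightarrow>
   ('k, 'b::ab_group_add) hopf_data \<Rightarrow> ('h \<Rightarrow> 'b \<Rightarrow> 'b) \<Rightarrow> ('c \<Rightarrow> 'b \<Rightarrow> 'k) \<Rightarrow>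
   ('k, 'd::ab_group_add) alg_data \<Rightarrow> ('c \<Rightarrow> 'h \<Rightarrow> 'b \<Rightarrow> 'd) \<Rightarrow> bool" where
  "is_Heis H R C actC B actB ev E \<tau> \<longleftrightarrow>
     (let inC = (\<lambda>c. \<tau> c (one H) (one B));
          inH = (\<lambda>h. \<tau> (one C) h (one B));
          inB = (\<lambda>b. \<tau> (one C) (one H) b)
      in bosonized_algebra H C actC B actB E \<tau> \<and>
         (\<forall>b c. inC c \<cdot>\<^bsub>E\<^esub> inB b =
            (\<Sum>(b1, b2)\<leftarrow>comul B b. \<Sum>(c1, c2)\<leftarrow>comul C c. \<Sum>(r1, r2)\<leftarrow>R.
               scl E (ev c1 (actB r2 b1)) (inB b2 \<cdot>\<^bsub>E\<^esub> inH r1 \<cdot>\<^bsub>E\<^esub> inC c2))))"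

definition is_Drin ::
  "('k::field, 'h::ab_group_add) hopf_data \<Rightarrow> ('h \<times> 'h) list \<Rightarrow>
   ('k, 'c::ab_group_add) hopf_data \<Rightarrow> ('h \<Rightarrow> 'c \<Rightarrow> 'c) \<Rightarrow>
   ('k, 'b::ab_group_add) hopf_data \<Rightarrow> ('h \<Rightarrow> 'b \<Rightarrow> 'b) \<Rightarrow> ('c \<Rightarrow> 'b \<Rightarrow> 'k) \<Rightarrow>
   ('k, 'd::ab_group_add) hopf_data \<Rightarrow> ('c \<Rightarrow> 'h \<Rightarrow> 'b \<Rightarrow> 'd) \<Rightarrow> bool" where
  "is_Drin H R C actC B actB ev D \<tau> \<longleftrightarrow>
     (let inC = (\<lambda>c. \<tau> c (one H) (one B));
          inH = (\<lambda>h. \<tau> (one C) h (one B));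
          inB = (\<lambda>b. \<tau> (one C) (one H) b)
      in bosonized_algebra H C actC B actB D \<tau> \<and>
         (\<forall>b c.
            (\<Sum>(b1, b2)\<leftarrow>comul B b. \<Sum>(c1, c2)\<leftarrow>comul C c. \<Sum>(r1, r2)\<leftarrow>R.
               scl D (ev c1 (actB r2 b1)) (inB b2 \<cdot>\<^bsub>D\<^esub> inH r1 \<cdot>\<^bsub>D\<^esub> inC c2)) =
            (\<Sum>(b1, b2)\<leftarrow>comul B b. \<Sum>(c1, c2)\<leftarrow>comul C c. \<Sum>(r1, r2)\<leftarrow>R.
               scl D (ev (actC r1 c2) b2) (inC c1 \<cdot>\<^bsub>D\<^esub> inH r2 \<cdot>\<^bsub>D\<^esub> inB b1))) \<and>
         hopf_algebra D \<and>
         (\<forall>h. tensor2_eq (scl D) (scl D) (comul D (inH h))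
                [(inH h1, inH h2). (h1, h2) \<leftarrow> comul H h]) \<and>
         (\<forall>b. tensor2_eq (scl D) (scl D) (comul D (inB b))
                [(inB (actB r2 b1), inB b2 \<cdot>\<^bsub>D\<^esub> inH r1).
                   (b1, b2) \<leftarrow> comul B b, (r1, r2) \<leftarrow> R]) \<and>
         (\<forall>c. tensor2_eq (scl D) (scl D) (comul D (inC c))
                [(inC c1 \<cdot>\<^bsub>D\<^esub> inH r2, inC (actC r1 c2)).
                   (c1, c2) \<leftarrow> comul C c, (r1, r2) \<leftarrow> R]) \<and>
         (\<forall>c h b. counit D (\<tau> c h b) = counit C c * counit H h * counit B b))"


section \<open>Right cocycle twists\<close>

definition cocycle_twist ::
  "('k::field, 'd::ab_group_add) hopf_data \<Rightarrow> ('d \<Rightarrow> 'd \<Rightarrow> 'k) \<Rightarrow> ('k, 'd) alg_data" where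
  "cocycle_twist D \<sigma> =
     \<lparr>scl = scl D,
      mul = (\<lambda>x y. \<Sum>(x1, x2)\<leftarrow>comul D x. \<Sum>(y1, y2)\<leftarrow>comul D y. scl D (\<sigma> x2 y2) (x1 \<cdot>\<^bsub>D\<^esub> y1)),
      one = one D\<rparr>"

definition right_2cocycle ::
  "('k::field, 'd::ab_group_add) hopf_data \<Rightarrow> ('d \<Rightarrow> 'd \<Rightarrow> 'k) \<Rightarrow> bool" where
  "right_2cocycle D \<sigma> \<longleftrightarrow>
     bilinear_map (scl D) (scl D) (*) \<sigma> \<and> k_algebra (cocycle_twist D \<sigma>)"

end

theory Submission
  imports Defs
begin

text \<open>
  Put \<open>\<omega>(chb, c'h'b') = \<epsilon>(c) \<epsilon>(h) ev(c', b) \<epsilon>(h') \<epsilon>(b')\<close>. In terms of the ordinary coproduct of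
  \<open>Drin\<close> the left hand side of both cross relations is \<open>\<omega>(b\<^sub>1, c\<^sub>1) b\<^sub>2 c\<^sub>2\<close>, so with
  \<open>(f \<rhd> G)(x, y) = f(x\<^sub>1, y\<^sub>1) G(x\<^sub>2, y\<^sub>2)\<close> and \<open>(G \<lhd> f)(x, y) = G(x\<^sub>1, y\<^sub>1) f(x\<^sub>2, y\<^sub>2)\<close> the Heis relation
  says \<open>(\<omega> \<rhd> m\<^sub>E)(b, c) = cb\<close>, where \<open>m\<^sub>D\<close>, \<open>m\<^sub>E\<close> are the products of \<open>Drin\<close>, \<open>Heis\<close>. Sliding an R-matrix through \<open>B\<close> turns the right hand side of the Drin
  relation into \<open>((\<omega> \<rhd> m\<^sub>E) \<lhd> \<omega>)(b, c)\<close>, whence \<open>\<omega> \<rhd> m\<^sub>D = \<omega> \<rhd> m\<^sub>E \<lhd> \<omega>\<close>; all maps involved are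
  determined by their values on \<open>B \<times> C\<close>, being \<open>C\<close>-, \<open>H\<close>-linear on the left and \<open>H\<close>-, \<open>B\<close>-linear on the
  right. Finally \<open>\<sigma>\<close> is the two-sided convolution inverse of \<open>\<omega>\<close>, by antimultiplicativity of the
  braided antipode of \<open>B\<close> and \<open>(S \<otimes> id) R = R\<^sup>-\<^sup>1\<close>. Cancelling \<open>\<omega>\<close> on the left gives \<open>m\<^sub>D = m\<^sub>E \<lhd> \<omega>\<close>, and
  hence \<open>m\<^sub>D \<lhd> \<sigma> = m\<^sub>E\<close>. The cocycle property of \<open>\<sigma>\<close> is then inherited from the algebra \<open>Heis\<close>.
\<close>

section \<open>Multilinear algebra\<close>

abbreviation linear_on :: "('k::field \<Rightarrow> 'v::ab_group_add \<Rightarrow> 'v) \<Rightarrow> ('k \<Rightarrow> 'w::ab_group_add \<Rightarrow> 'w) \<Rightarrow> ('v \<Rightarrow> 'w) \<Rightarrow> bool"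
  where "linear_on \<equiv> Vector_Spaces.linear"

lemma
  assumes "vector_space s"
  shows vs_distrib_right: "s a (x + y) = s a x + s a y"
    and vs_distrib_left: "s (a + b) x = s a x + s b x"
    and vs_assoc: "s a (s b x) = s (a * b) x"
    and vs_one: "s 1 x = x"
    and vs_zero_right: "s a 0 = 0"
proof -
  interpret vector_space s by fact
  show "s a (x + y) = s a x + s a y" "s (a + b) x = s a x + s b x" "s a (s b x) = s (a * b) x"
    "s 1 x = x" "s a 0 = 0"
    by (simp_all add: scale_right_distrib scale_left_distrib)
qed

lemma linear_onI:
  assumes "vector_space s" "vector_space t" "\<And>x y. f (x + y) = f x + f y" "\<And>a x. f (s a x) = t a (f x)"
  shows "linear_on s t f"
  using assms by (auto simp: Vector_Spaces.linear_def module_hom_def module_hom_axioms_def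
      vector_space_def module_def)

lemma
  assumes "linear_on s t f"
  shows linear_on_vs1: "vector_space s" and linear_on_vs2: "vector_space t"
    and linear_on_add: "f (x + y) = f x + f y" and linear_on_scale: "f (s a x) = t a (f x)"
    and linear_on_zero: "f 0 = 0"
    and linear_on_sum: "f (\<Sum>(u, v)\<leftarrow>l. g u v) = (\<Sum>(u, v)\<leftarrow>l. f (g u v))"
    and linear_on_sum3: "f (\<Sum>(u, v, w)\<leftarrow>l3. h u v w) = (\<Sum>(u, v, w)\<leftarrow>l3. f (h u v w))"
proof -
  interpret Vector_Spaces.linear s t f by fact
  show "vector_space s" "vector_space t" by unfold_locales
  show "f (x + y) = f x + f y" by (rule add)
  show "f (s a x) = t a (f x)" by (rule scale)
  show z: "f 0 = 0" by (rule zero)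
  show "f (\<Sum>(u, v)\<leftarrow>l. g u v) = (\<Sum>(u, v)\<leftarrow>l. f (g u v))"
    by (induction l) (auto simp: z add)
  show "f (\<Sum>(u, v, w)\<leftarrow>l3. h u v w) = (\<Sum>(u, v, w)\<leftarrow>l3. f (h u v w))"
    by (induction l3) (auto simp: z add)
qed

lemma linear_on_id: "vector_space s \<Longrightarrow> linear_on s s (\<lambda>x. x)"
  by (rule linear_onI) auto

lemma linear_on_compose: "linear_on s t f \<Longrightarrow> linear_on r s g \<Longrightarrow> linear_on r t (\<lambda>x. f (g x))"
  by (rule linear_onI) (auto simp: linear_on_add linear_on_scale linear_on_vs1 linear_on_vs2)

lemma vector_space_field: "vector_space ((*) :: 'k::field \<Rightarrow> 'k \<Rightarrow> 'k)"
  by unfold_locales (auto simp: algebra_simps)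

lemma bilinear_mapI:
  "(\<And>w. linear_on s t (\<lambda>v. f v w)) \<Longrightarrow> (\<And>v. linear_on r t (\<lambda>w. f v w)) \<Longrightarrow> bilinear_map s r t f"
  by (simp add: bilinear_map_def)

lemma bilinear_map_left: "bilinear_map s1 s2 t f \<Longrightarrow> linear_on s s1 g \<Longrightarrow> linear_on s t (\<lambda>x. f (g x) y)"
  unfolding bilinear_map_def by (rule linear_on_compose[of s1 t "\<lambda>v. f v y"]) auto

lemma bilinear_map_right: "bilinear_map s1 s2 t f \<Longrightarrow> linear_on s s2 g \<Longrightarrow> linear_on s t (\<lambda>x. f y (g x))"
  unfolding bilinear_map_def by (rule linear_on_compose[of s2 t "\<lambda>v. f y v"]) auto

lemma
  assumes "bilinear_map s1 s2 t f"
  shows bilinear_map_sum_left: "f (\<Sum>(u, v)\<leftarrow>l. g u v) y = (\<Sum>(u, v)\<leftarrow>l. f (g u v) y)"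
    and bilinear_map_sum_right: "f x (\<Sum>(u, v)\<leftarrow>l'. h u v) = (\<Sum>(u, v)\<leftarrow>l'. f x (h u v))"
    and bilinear_map_scale_left: "f (s1 a x) y = t a (f x y)"
    and bilinear_map_scale_right: "f x (s2 a y) = t a (f x y)"
proof -
  have l: "linear_on s1 t (\<lambda>x. f x y)" and r: "linear_on s2 t (f x)" for x y
    using assms by (auto simp: bilinear_map_def)
  show "f (\<Sum>(u, v)\<leftarrow>l. g u v) y = (\<Sum>(u, v)\<leftarrow>l. f (g u v) y)"
    by (rule linear_on_sum[OF l])
  show "f x (\<Sum>(u, v)\<leftarrow>l'. h u v) = (\<Sum>(u, v)\<leftarrow>l'. f x (h u v))"
    by (rule linear_on_sum[OF r])
  show "f (s1 a x) y = t a (f x y)" by (rule linear_on_scale[OF l])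
  show "f x (s2 a y) = t a (f x y)" by (rule linear_on_scale[OF r])
qed

lemma bilinear_map_scale: "vector_space t \<Longrightarrow> bilinear_map (*) t t t"
  by (intro bilinear_mapI linear_onI)
    (auto simp: vector_space_field vs_distrib_left
      vs_distrib_right vs_assoc mult.commute)

lemma bilinear_map_times: "bilinear_map (*) (*) (*) ((*) :: 'k::field \<Rightarrow> 'k \<Rightarrow> 'k)"
  by (rule bilinear_map_scale[OF vector_space_field])

lemma bilinear_map_flip: "bilinear_map s r t f \<Longrightarrow> bilinear_map r s t (\<lambda>x y. f y x)"
  by (simp add: bilinear_map_def)

section \<open>Sums over formal tensors\<close>

lemma tsum_swap:
  fixes f :: "'a \<Rightarrow> 'b \<Rightarrow> 'c \<Rightarrow> 'd \<Rightarrow> 'e::ab_group_add"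
  shows "(\<Sum>(x, y)\<leftarrow>s. \<Sum>(u, v)\<leftarrow>t. f x y u v) = (\<Sum>(u, v)\<leftarrow>t. \<Sum>(x, y)\<leftarrow>s. f x y u v)"
proof (induction s)
  case Nil
  have "(\<Sum>(u, v)\<leftarrow>t. 0 :: 'e) = 0" by (induction t) auto
  then show ?case by simp
next
  case (Cons a s)
  have add: "(\<Sum>(u, v)\<leftarrow>t. g u v + h u v) = (\<Sum>(u, v)\<leftarrow>t. g u v) + (\<Sum>(u, v)\<leftarrow>t. h u v)"
    for g h :: "'c \<Rightarrow> 'd \<Rightarrow> 'e" by (induction t) (auto simp: algebra_simps)
  show ?case by (cases a) (simp add: Cons add)
qed

lemma tsum_cong:
  "(\<And>x y. (x, y) \<in> set s \<Longrightarrow> f x y = g x y) \<Longrightarrow> (\<Sum>(x, y)\<leftarrow>s. f x y) = (\<Sum>(x, y)\<leftarrow>s. g x y)"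
  by (rule arg_cong[where f=sum_list], rule map_cong) auto

lemma tsum_cong':
  "(\<And>x y. f x y = g x y) \<Longrightarrow> (\<Sum>(x, y)\<leftarrow>s. f x y) = (\<Sum>(x, y)\<leftarrow>s. g x y)"
  by (rule tsum_cong)

lemma linear_on_tsum:
  assumes "vector_space s" "vector_space t" "\<And>u v. linear_on s t (\<lambda>x. f x u v)"
  shows "linear_on s t (\<lambda>x. \<Sum>(u, v)\<leftarrow>l. f x u v)"
proof (induction l)
  case Nil
  then show ?case using assms(1,2) by (intro linear_onI) (auto simp: vs_zero_right)
next
  case (Cons a l)
  obtain u v where "a = (u, v)" by force
  then show ?case using assms(1,2) Cons
    by (intro linear_onI) (auto simp: linear_on_add[OF assms(3)] linear_on_scale[OF assms(3)]
        vs_distrib_right dest: linear_on_add linear_on_scale)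
qed

lemma tsum_reverse:
  fixes f :: "'a \<Rightarrow> 'b \<Rightarrow> 'c \<Rightarrow> 'd \<Rightarrow> 'g \<Rightarrow> 'h \<Rightarrow> 'e::ab_group_add"
  shows "(\<Sum>(x, y)\<leftarrow>s. \<Sum>(u, v)\<leftarrow>t. \<Sum>(p, q)\<leftarrow>r. f x y u v p q) =
    (\<Sum>(p, q)\<leftarrow>r. \<Sum>(u, v)\<leftarrow>t. \<Sum>(x, y)\<leftarrow>s. f x y u v p q)"
proof -
  have "(\<Sum>(x, y)\<leftarrow>s. \<Sum>(u, v)\<leftarrow>t. \<Sum>(p, q)\<leftarrow>r. f x y u v p q) =
    (\<Sum>(x, y)\<leftarrow>s. \<Sum>(p, q)\<leftarrow>r. \<Sum>(u, v)\<leftarrow>t. f x y u v p q)"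
    by (rule tsum_cong', rule tsum_swap)
  also have "\<dots> = (\<Sum>(p, q)\<leftarrow>r. \<Sum>(x, y)\<leftarrow>s. \<Sum>(u, v)\<leftarrow>t. f x y u v p q)"
    by (rule tsum_swap)
  also have "\<dots> = (\<Sum>(p, q)\<leftarrow>r. \<Sum>(u, v)\<leftarrow>t. \<Sum>(x, y)\<leftarrow>s. f x y u v p q)"
    by (rule tsum_cong', rule tsum_swap)
  finally show ?thesis .
qed

text \<open>Each generating rule of the congruence is respected by a map that is linear in both
  legs, so such a sum depends only on the tensor and not on its representing list. Through this
  lemma an identity of tensors becomes an identity of sums.\<close>

lemma tensor2_eq_sum:
  assumes "tensor2_eq sV sW s s'" "\<And>w. linear_on sV t (\<lambda>v. f v w)" "\<And>v. linear_on sW t (\<lambda>w. f v w)"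
  shows "(\<Sum>(v, w)\<leftarrow>s. f v w) = (\<Sum>(v, w)\<leftarrow>s'. f v w)"
  using assms(1)
  by induction (auto simp: linear_on_add[OF assms(2)] linear_on_add[OF assms(3)] linear_on_zero[OF assms(2)]
      linear_on_scale[OF assms(2)] linear_on_scale[OF assms(3)])

lemma tensor3_eq_sum:
  assumes "tensor3_eq sU sV sW s s'" "\<And>v w. linear_on sU t (\<lambda>u. f u v w)"
    "\<And>u w. linear_on sV t (\<lambda>v. f u v w)" "\<And>u v. linear_on sW t (\<lambda>w. f u v w)"
  shows "(\<Sum>(u, v, w)\<leftarrow>s. f u v w) = (\<Sum>(u, v, w)\<leftarrow>s'. f u v w)"
  using assms(1)
  by induction (auto simp: linear_on_add[OF assms(2)] linear_on_add[OF assms(3)] linear_on_add[OF assms(4)]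
      linear_on_zero[OF assms(2)]
      linear_on_scale[OF assms(2)] linear_on_scale[OF assms(3)] linear_on_scale[OF assms(4)])

text \<open>The list-valued map \<open>\<delta>\<close> is linear only up to
  \<open>tensor2_eq\<close>. Summing a bilinear \<open>f\<close> over the list removes this
  ambiguity and leaves an honest linear map; this is how linearity of Sweedler expressions is
  proved.\<close>

lemma linear_on_to_tensor2:
  assumes "linear_to_tensor2 sX sV sW \<delta>" "vector_space sX" "linear_on s sX g"
    and f: "\<And>w. linear_on sV t (\<lambda>v. f v w)" "\<And>v. linear_on sW t (\<lambda>w. f v w)"
  shows "linear_on s t (\<lambda>x. \<Sum>(v, w)\<leftarrow>\<delta> (g x). f v w)"
proof (rule linear_on_compose[OF linear_onI assms(3)])
  fix x y a
  show "(\<Sum>(v, w)\<leftarrow>\<delta> (x + y). f v w) = (\<Sum>(v, w)\<leftarrow>\<delta> x. f v w) + (\<Sum>(v, w)\<leftarrow>\<delta> y. f v w)"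
    using assms(1) by (subst tensor2_eq_sum[where s'="\<delta> x @ \<delta> y", OF _ f])
      (auto simp: linear_to_tensor2_def)
  have "(\<Sum>(v, w)\<leftarrow>\<delta> (sX a x). f v w) = (\<Sum>(v, w)\<leftarrow>[(sV a v, w). (v, w) \<leftarrow> \<delta> x]. f v w)"
    using assms(1) by (intro tensor2_eq_sum[OF _ f]) (auto simp: linear_to_tensor2_def)
  also have "\<dots> = (\<Sum>(v, w)\<leftarrow>\<delta> x. f (sV a v) w)"
    by (induction "\<delta> x") (auto simp: case_prod_unfold comp_def)
  also have "\<dots> = t a (\<Sum>(v, w)\<leftarrow>\<delta> x. f v w)"
    by (simp add: linear_on_scale[OF f(1)]
        bilinear_map_sum_right[OF bilinear_map_scale[OF linear_on_vs2[OF f(1)]]])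
  finally show "(\<Sum>(v, w)\<leftarrow>\<delta> (sX a x). f v w) = t a (\<Sum>(v, w)\<leftarrow>\<delta> x. f v w)" .
qed (use assms(2) linear_on_vs2[OF f(1)] in auto)

section \<open>Universal property of the threefold tensor product\<close>

lemma tensor_product3_lift:
  assumes T: "is_tensor_product3 sU sV sW sX \<tau>" and F: "trilinear_map sU sV sW sY \<phi>"
  obtains L where "linear_on sX sY L" "\<And>u v w. L (\<tau> u v w) = \<phi> u v w"
proof -
  have \<tau>: "linear_on sU sX (\<lambda>u. \<tau> u v w)" "linear_on sV sX (\<lambda>v. \<tau> u v w)" "linear_on sW sX (\<lambda>w. \<tau> u v w)" for u v w
    using T by (auto simp: is_tensor_product3_def trilinear_map_def)
  have \<phi>: "linear_on sU sY (\<lambda>u. \<phi> u v w)" "linear_on sV sY (\<lambda>v. \<phi> u v w)" "linear_on sW sY (\<lambda>w. \<phi> u v w)" for u v w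
    using F by (auto simp: trilinear_map_def)
  let ?T = "\<lambda>s. \<Sum>(u, v, w)\<leftarrow>s. \<tau> u v w" and ?P = "\<lambda>s. \<Sum>(u, v, w)\<leftarrow>s. \<phi> u v w"
  have wd: "?P s = ?P t" if "?T s = ?T t" for s t
    using T that by (intro tensor3_eq_sum[OF _ \<phi>]) (auto simp: is_tensor_product3_def)
  \<comment> \<open>An arbitrary representing list is chosen. By \<open>wd\<close> the value does
    not depend on the choice, since lists with equal image under \<open>\<tau>\<close> are
    congruent.\<close>
  define L where "L x = ?P (SOME s. x = ?T s)" for x
  have L: "L (?T s) = ?P s" for s
    unfolding L_def by (rule wd) (metis (mono_tags, lifting) someI)
  have ex: "\<exists>s. x = ?T s" for x using T by (auto simp: is_tensor_product3_def)
  have "linear_on sX sY L"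
  proof (rule linear_onI)
    show "vector_space sX" "vector_space sY" using linear_on_vs2 \<tau>(1) \<phi>(1) by blast+
    show "L (x + y) = L x + L y" for x y
    proof -
      obtain s t where "x = ?T s" "y = ?T t" using ex by meson
      then show ?thesis using L[of "s @ t"] L[of s] L[of t] by simp
    qed
    show "L (sX a x) = sY a (L x)" for a x
    proof -
      obtain s where s: "x = ?T s" using ex by meson
      have "sX a x = ?T (map (\<lambda>(u, v, w). (sU a u, v, w)) s)"
        unfolding s by (induction s)
          (auto simp: linear_on_scale[OF \<tau>(1)] vs_distrib_right[OF \<open>vector_space sX\<close>]
            vs_zero_right[OF \<open>vector_space sX\<close>])
      moreover have "sY a (?P s) = ?P (map (\<lambda>(u, v, w). (sU a u, v, w)) s)"
        by (induction s)
          (auto simp: linear_on_scale[OF \<phi>(1)] vs_distrib_right[OF \<open>vector_space sY\<close>]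
            vs_zero_right[OF \<open>vector_space sY\<close>])
      ultimately show ?thesis using L s by metis
    qed
  qed
  moreover have "L (\<tau> u v w) = \<phi> u v w" for u v w using L[of "[(u, v, w)]"] by simp
  ultimately show thesis by (rule that)
qed

lemma tensor_product3_ext:
  assumes "is_tensor_product3 sU sV sW sX \<tau>"
    and "linear_on sX sY f" "linear_on sX sY g" "\<And>u v w. f (\<tau> u v w) = g (\<tau> u v w)"
  shows "f x = g x"
proof -
  obtain s where "x = (\<Sum>(u, v, w)\<leftarrow>s. \<tau> u v w)"
    using assms(1) unfolding is_tensor_product3_def by meson
  then show ?thesis by (simp add: linear_on_sum3[OF assms(2)] linear_on_sum3[OF assms(3)] assms(4))
qed

section \<open>Hopf algebras and R-matrices\<close>

text \<open>\<open>linear_intros\<close> discharges the multilinearity side conditions of all tensor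
  arguments by introduction. \<open>tsum_pull\<close> consists of rewrite rules that move sums and
  scalars out of multilinear maps, so that two Sweedler expressions meet in a common normal
  form.\<close>

named_theorems linear_intros
named_theorems tsum_pull

declare linear_on_id [linear_intros] linear_on_tsum [linear_intros] vector_space_field [linear_intros]

lemma sum_list_map_concat: "sum_list (map f (concat xs)) = (\<Sum>x\<leftarrow>xs. sum_list (map f x))"
  by (induction xs) auto

lemmas tensor_comprehension = sum_list_map_concat case_prod_unfold comp_def

lemma linear_on_scale_left [linear_intros]:
  "vector_space t \<Longrightarrow> linear_on s (*) f \<Longrightarrow> linear_on s t (\<lambda>x. t (f x) v)"
  by (rule bilinear_map_left[OF bilinear_map_scale])

lemma linear_on_scale_right [linear_intros]:
  "vector_space t \<Longrightarrow> linear_on s t f \<Longrightarrow> linear_on s t (\<lambda>x. t a (f x))"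
  by (rule bilinear_map_right[OF bilinear_map_scale])

lemma linear_on_times_left [linear_intros]:
  "linear_on s (*) f \<Longrightarrow> linear_on s (*) (\<lambda>x. f x * v)"
  by (rule bilinear_map_left[OF bilinear_map_times])

lemma linear_on_times_right [linear_intros]:
  "linear_on s (*) f \<Longrightarrow> linear_on s (*) (\<lambda>x. v * f x)"
  by (rule bilinear_map_right[OF bilinear_map_times])

lemmas scale_pull = bilinear_map_sum_left[OF bilinear_map_scale]
  bilinear_map_sum_right[OF bilinear_map_scale] vs_assoc
lemmas bilinear_map_pull = bilinear_map_sum_left bilinear_map_sum_right
  bilinear_map_scale_left bilinear_map_scale_right

lemmas [tsum_pull] = bilinear_map_sum_left[OF bilinear_map_times] bilinear_map_sum_right[OF bilinear_map_times]

lemma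
  assumes "k_algebra A"
  shows k_algebra_vector_space: "vector_space (scl A)"
    and k_algebra_mul: "bilinear_map (scl A) (scl A) (scl A) (mul A)"
    and k_algebra_assoc: "(x \<cdot>\<^bsub>A\<^esub> y) \<cdot>\<^bsub>A\<^esub> z = x \<cdot>\<^bsub>A\<^esub> (y \<cdot>\<^bsub>A\<^esub> z)"
    and k_algebra_one_left: "one A \<cdot>\<^bsub>A\<^esub> x = x"
    and k_algebra_one_right: "x \<cdot>\<^bsub>A\<^esub> one A = x"
  using assms by (auto simp: k_algebra_def)

text \<open>The coalgebra axioms are restated against multilinear test maps with values in any space
  \<open>t\<close>. In this shape they can be applied in the middle of a longer Sweedler
  expression.\<close>

lemma
  assumes A: "k_coalgebra A"
  shows k_coalgebra_vector_space: "vector_space (scl A)"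
    and k_coalgebra_comul_linear: "linear_on s (scl A) g \<Longrightarrow> (\<And>w. linear_on (scl A) t (\<lambda>v. f v w)) \<Longrightarrow>
      (\<And>v. linear_on (scl A) t (\<lambda>w. f v w)) \<Longrightarrow> linear_on s t (\<lambda>x. \<Sum>(v, w)\<leftarrow>comul A (g x). f v w)"
    and k_coalgebra_counit_linear: "linear_on s (scl A) g \<Longrightarrow> linear_on s (*) (\<lambda>x. counit A (g x))"
    and k_coalgebra_coassoc: "(\<And>v w. linear_on (scl A) t (\<lambda>u. h u v w)) \<Longrightarrow>
      (\<And>u w. linear_on (scl A) t (\<lambda>v. h u v w)) \<Longrightarrow> (\<And>u v. linear_on (scl A) t (\<lambda>w. h u v w)) \<Longrightarrow>
      (\<Sum>(x1, x2)\<leftarrow>comul A x. \<Sum>(x11, x12)\<leftarrow>comul A x1. h x11 x12 x2) =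
      (\<Sum>(x1, x2)\<leftarrow>comul A x. \<Sum>(x21, x22)\<leftarrow>comul A x2. h x1 x21 x22)"
    and k_coalgebra_counit_left: "linear_on (scl A) t k \<Longrightarrow> (\<Sum>(x1, x2)\<leftarrow>comul A x. t (counit A x1) (k x2)) = k x"
    and k_coalgebra_counit_right: "linear_on (scl A) t k \<Longrightarrow> (\<Sum>(x1, x2)\<leftarrow>comul A x. t (counit A x2) (k x1)) = k x"
proof -
  show vs: "vector_space (scl A)" using A by (simp add: k_coalgebra_def)
  show "linear_on s t (\<lambda>x. \<Sum>(v, w)\<leftarrow>comul A (g x). f v w)"
    if "linear_on s (scl A) g" "\<And>w. linear_on (scl A) t (\<lambda>v. f v w)" "\<And>v. linear_on (scl A) t (\<lambda>w. f v w)"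
    using A by (intro linear_on_to_tensor2[OF _ vs that]) (simp add: k_coalgebra_def)
  show "linear_on s (*) (\<lambda>x. counit A (g x))" if "linear_on s (scl A) g"
    using A by (intro linear_on_compose[OF _ that]) (simp add: k_coalgebra_def)
  show "(\<Sum>(x1, x2)\<leftarrow>comul A x. \<Sum>(x11, x12)\<leftarrow>comul A x1. h x11 x12 x2) =
      (\<Sum>(x1, x2)\<leftarrow>comul A x. \<Sum>(x21, x22)\<leftarrow>comul A x2. h x1 x21 x22)"
    if h: "\<And>v w. linear_on (scl A) t (\<lambda>u. h u v w)"
      "\<And>u w. linear_on (scl A) t (\<lambda>v. h u v w)" "\<And>u v. linear_on (scl A) t (\<lambda>w. h u v w)"
    using A tensor3_eq_sum[OF _ h,
        of "[(x11, x12, x2). (x1, x2) \<leftarrow> comul A x, (x11, x12) \<leftarrow> comul A x1]"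
           "[(x1, x21, x22). (x1, x2) \<leftarrow> comul A x, (x21, x22) \<leftarrow> comul A x2]"]
    by (simp add: k_coalgebra_def tensor_comprehension)
  show "(\<Sum>(x1, x2)\<leftarrow>comul A x. t (counit A x1) (k x2)) = k x" if k: "linear_on (scl A) t k"
    using A by (simp add: k_coalgebra_def linear_on_scale[OF k, symmetric] linear_on_sum[OF k, symmetric])
  show "(\<Sum>(x1, x2)\<leftarrow>comul A x. t (counit A x2) (k x1)) = k x" if k: "linear_on (scl A) t k"
    using A by (simp add: k_coalgebra_def linear_on_scale[OF k, symmetric] linear_on_sum[OF k, symmetric])
qed

text \<open>This is coassociativity of the coalgebra \<open>A \<otimes> A\<close>, tested on
  six-linear maps. The sums are interleaved so that coassociativity can be applied first to
  \<open>y\<close> and then to \<open>x\<close>.\<close>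

lemma k_coalgebra_coassoc2:
  assumes A: "k_coalgebra A"
    and h: "\<And>u2 u3 v1 v2 v3. linear_on (scl A) t (\<lambda>u. h u u2 u3 v1 v2 v3)"
    "\<And>u1 u3 v1 v2 v3. linear_on (scl A) t (\<lambda>u. h u1 u u3 v1 v2 v3)"
    "\<And>u1 u2 v1 v2 v3. linear_on (scl A) t (\<lambda>u. h u1 u2 u v1 v2 v3)"
    "\<And>u1 u2 u3 v2 v3. linear_on (scl A) t (\<lambda>u. h u1 u2 u3 u v2 v3)"
    "\<And>u1 u2 u3 v1 v3. linear_on (scl A) t (\<lambda>u. h u1 u2 u3 v1 u v3)"
    "\<And>u1 u2 u3 v1 v2. linear_on (scl A) t (\<lambda>u. h u1 u2 u3 v1 v2 u)"
  shows "(\<Sum>(x1, x2)\<leftarrow>comul A x. \<Sum>(y1, y2)\<leftarrow>comul A y. \<Sum>(x11, x12)\<leftarrow>comul A x1. \<Sum>(y11, y12)\<leftarrow>comul A y1.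
       h x11 x12 x2 y11 y12 y2) =
     (\<Sum>(x1, x2)\<leftarrow>comul A x. \<Sum>(y1, y2)\<leftarrow>comul A y. \<Sum>(x21, x22)\<leftarrow>comul A x2. \<Sum>(y21, y22)\<leftarrow>comul A y2.
       h x1 x21 x22 y1 y21 y22)"
proof -
  note [linear_intros] = k_coalgebra_vector_space[OF A] linear_on_vs2[OF h(1)] h
  have "(\<Sum>(x1, x2)\<leftarrow>comul A x. \<Sum>(y1, y2)\<leftarrow>comul A y. \<Sum>(x11, x12)\<leftarrow>comul A x1. \<Sum>(y11, y12)\<leftarrow>comul A y1.
       h x11 x12 x2 y11 y12 y2) =
     (\<Sum>(x1, x2)\<leftarrow>comul A x. \<Sum>(x11, x12)\<leftarrow>comul A x1. \<Sum>(y1, y2)\<leftarrow>comul A y. \<Sum>(y11, y12)\<leftarrow>comul A y1.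
       h x11 x12 x2 y11 y12 y2)"
    by (rule tsum_cong', rule tsum_swap)
  also have "\<dots> = (\<Sum>(x1, x2)\<leftarrow>comul A x. \<Sum>(x11, x12)\<leftarrow>comul A x1. \<Sum>(y1, y2)\<leftarrow>comul A y.
      \<Sum>(y21, y22)\<leftarrow>comul A y2. h x11 x12 x2 y1 y21 y22)"
    by (rule tsum_cong', rule tsum_cong', rule k_coalgebra_coassoc[OF A, where t=t]) (intro linear_intros)+
  also have "\<dots> = (\<Sum>(x1, x2)\<leftarrow>comul A x. \<Sum>(x21, x22)\<leftarrow>comul A x2. \<Sum>(y1, y2)\<leftarrow>comul A y.
      \<Sum>(y21, y22)\<leftarrow>comul A y2. h x1 x21 x22 y1 y21 y22)"
    by (rule k_coalgebra_coassoc[OF A, where t=t]) (intro linear_intros)+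
  also have "\<dots> = (\<Sum>(x1, x2)\<leftarrow>comul A x. \<Sum>(y1, y2)\<leftarrow>comul A y. \<Sum>(x21, x22)\<leftarrow>comul A x2.
      \<Sum>(y21, y22)\<leftarrow>comul A y2. h x1 x21 x22 y1 y21 y22)"
    by (rule tsum_cong', rule tsum_swap)
  finally show ?thesis .
qed

lemma
  assumes "is_antipode A"
  shows antipode_linear: "linear_on s (scl A) g \<Longrightarrow> linear_on s (scl A) (\<lambda>x. antipode A (g x))"
    and antipode_left: "(\<Sum>(x1, x2)\<leftarrow>comul A x. antipode A x1 \<cdot>\<^bsub>A\<^esub> x2) = scl A (counit A x) (one A)"
    and antipode_right: "(\<Sum>(x1, x2)\<leftarrow>comul A x. x1 \<cdot>\<^bsub>A\<^esub> antipode A x2) = scl A (counit A x) (one A)"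
  using assms by (auto simp: is_antipode_def intro: linear_on_compose)

lemma antipode_one:
  assumes "k_algebra A" "is_antipode A" "counit_multiplicative A"
    "tensor2_eq (scl A) (scl A) (comul A (one A)) [(one A, one A)]"
  shows "antipode A (one A) = one A"
proof -
  have S: "linear_on (scl A) (scl A) (antipode A)"
    using assms(2) by (simp add: is_antipode_def)
  have "antipode A (one A) = antipode A (one A) \<cdot>\<^bsub>A\<^esub> one A"
    by (simp add: k_algebra_one_right[OF assms(1)])
  also have "\<dots> = (\<Sum>(x, y)\<leftarrow>[(one A, one A)]. antipode A x \<cdot>\<^bsub>A\<^esub> y)" by simp
  also have "\<dots> = (\<Sum>(x1, x2)\<leftarrow>comul A (one A). antipode A x1 \<cdot>\<^bsub>A\<^esub> x2)"
    by (rule tensor2_eq_sum[OF assms(4), symmetric, where t="scl A"])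
      (intro bilinear_map_left[OF k_algebra_mul] bilinear_map_right[OF k_algebra_mul] S linear_on_id
        k_algebra_vector_space assms)+
  also have "\<dots> = one A"
    using assms(1,3) by (simp add: antipode_left[OF assms(2)] counit_multiplicative_def k_algebra_def vs_one)
  finally show ?thesis .
qed

locale hopf =
  fixes H :: "('k::field, 'h::ab_group_add) hopf_data"
  assumes hopf_algebra: "hopf_algebra H"
begin

lemma H_parts: "k_algebra H" "k_coalgebra H" "counit_multiplicative H" "is_antipode H"
  using hopf_algebra by (auto simp: hopf_algebra_def)

lemmas H_vs [linear_intros] = k_algebra_vector_space[OF H_parts(1)]
lemmas H_mul = k_algebra_mul[OF H_parts(1)]
lemmas [linear_intros] = bilinear_map_left[OF H_mul] bilinear_map_right[OF H_mul]
  k_coalgebra_comul_linear[OF H_parts(2)] k_coalgebra_counit_linear[OF H_parts(2)]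
  antipode_linear[OF H_parts(4)]
lemmas [tsum_pull] = bilinear_map_pull[OF H_mul] scale_pull[OF H_vs]
lemmas H_assoc = k_algebra_assoc[OF H_parts(1)]
lemmas H_one [simp] = k_algebra_one_left[OF H_parts(1)] k_algebra_one_right[OF H_parts(1)]
lemmas H_coassoc = k_coalgebra_coassoc[OF H_parts(2)]
lemmas H_counit = k_coalgebra_counit_left[OF H_parts(2)] k_coalgebra_counit_right[OF H_parts(2)]
lemmas H_antipode = antipode_left[OF H_parts(4)] antipode_right[OF H_parts(4)]
lemma counit_H [simp]: "counit H (x \<cdot>\<^bsub>H\<^esub> y) = counit H x * counit H y" "counit H (one H) = 1"
  using H_parts(3) by (auto simp: counit_multiplicative_def)
lemma counit_linear: "linear_on (scl H) (*) (counit H)"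
  by (intro linear_intros)

lemma counit_H_scl: "counit H (scl H a x) = a * counit H x"
  by (rule linear_on_scale[OF counit_linear])

lemma comul_mul:
  assumes "\<And>w. linear_on (scl H) t (\<lambda>v. f v w)" "\<And>v. linear_on (scl H) t (\<lambda>w. f v w)"
  shows "(\<Sum>(z1, z2)\<leftarrow>comul H (x \<cdot>\<^bsub>H\<^esub> y). f z1 z2) =
    (\<Sum>(x1, x2)\<leftarrow>comul H x. \<Sum>(y1, y2)\<leftarrow>comul H y. f (x1 \<cdot>\<^bsub>H\<^esub> y1) (x2 \<cdot>\<^bsub>H\<^esub> y2))"
  using hopf_algebra tensor2_eq_sum[OF _ assms, of "comul H (x \<cdot>\<^bsub>H\<^esub> y)"
      "[(x1 \<cdot>\<^bsub>H\<^esub> y1, x2 \<cdot>\<^bsub>H\<^esub> y2). (x1, x2) \<leftarrow> comul H x, (y1, y2) \<leftarrow> comul H y]"]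
  by (simp add: hopf_algebra_def tensor_comprehension)

text \<open>Apply the counit to the antipode axiom: it is multiplicative, so the left side becomes
  \<epsilon>(S x1) \<epsilon>(x2), which the counit axiom contracts.\<close>

lemma counit_antipode: "counit H (antipode H x) = counit H x"
proof -
  have "counit H (antipode H x) = (\<Sum>(x1, x2)\<leftarrow>comul H x. counit H x2 * counit H (antipode H x1))"
    by (rule H_counit(2)[where t="(*)", symmetric]) (intro linear_intros)
  also have "\<dots> = counit H (\<Sum>(x1, x2)\<leftarrow>comul H x. antipode H x1 \<cdot>\<^bsub>H\<^esub> x2)"
    unfolding linear_on_sum[OF counit_linear] by (simp add: mult.commute)
  also have "\<dots> = counit H x" by (simp add: H_antipode counit_H_scl)
  finally show ?thesis .
qed

end

section \<open>Counit and antipode identities for the R-matrix\<close>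

locale quasitriangular =
  fixes H :: "('k::field, 'h::ab_group_add) hopf_data" and R :: "('h \<times> 'h) list"
  assumes quasitriangular: "quasitriangular_hopf_algebra H R"
begin

sublocale hopf H
  using quasitriangular by unfold_locales (simp add: quasitriangular_hopf_algebra_def)

lemma R_comul_left:
  assumes h: "\<And>v w. linear_on (scl H) t (\<lambda>u. h u v w)" "\<And>u w. linear_on (scl H) t (\<lambda>v. h u v w)"
    "\<And>u v. linear_on (scl H) t (\<lambda>w. h u v w)"
  shows "(\<Sum>(r1, r2)\<leftarrow>R. \<Sum>(r11, r12)\<leftarrow>comul H r1. h r11 r12 r2) =
    (\<Sum>(r1, r2)\<leftarrow>R. \<Sum>(r1', r2')\<leftarrow>R. h r1 r1' (r2 \<cdot>\<^bsub>H\<^esub> r2'))"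
  using quasitriangular tensor3_eq_sum[OF _ h,
        of "[(r11, r12, r2). (r1, r2) \<leftarrow> R, (r11, r12) \<leftarrow> comul H r1]"
           "[(r1, r1', r2 \<cdot>\<^bsub>H\<^esub> r2'). (r1, r2) \<leftarrow> R, (r1', r2') \<leftarrow> R]"]
  by (simp add: quasitriangular_hopf_algebra_def tensor_comprehension)

lemma R_comul_right:
  assumes h: "\<And>v w. linear_on (scl H) t (\<lambda>u. h u v w)" "\<And>u w. linear_on (scl H) t (\<lambda>v. h u v w)"
    "\<And>u v. linear_on (scl H) t (\<lambda>w. h u v w)"
  shows "(\<Sum>(r1, r2)\<leftarrow>R. \<Sum>(r21, r22)\<leftarrow>comul H r2. h r1 r21 r22) =
    (\<Sum>(r1, r2)\<leftarrow>R. \<Sum>(r1', r2')\<leftarrow>R. h (r1 \<cdot>\<^bsub>H\<^esub> r1') r2' r2)"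
  using quasitriangular tensor3_eq_sum[OF _ h,
        of "[(r1, r21, r22). (r1, r2) \<leftarrow> R, (r21, r22) \<leftarrow> comul H r2]"
           "[(r1 \<cdot>\<^bsub>H\<^esub> r1', r2', r2). (r1, r2) \<leftarrow> R, (r1', r2') \<leftarrow> R]"]
  by (simp add: quasitriangular_hopf_algebra_def tensor_comprehension)

text \<open>The test maps take values in \<open>H\<close> itself, because a type variable cannot be
  generalised under the existential quantifier over \<open>Q\<close>. This suffices for the two
  counit identities.\<close>

lemma R_right_inverse:
  "\<exists>Q. \<forall>f :: 'h \<Rightarrow> 'h \<Rightarrow> 'h. bilinear_map (scl H) (scl H) (scl H) f \<longrightarrow>
    (\<Sum>(r1, r2)\<leftarrow>R. \<Sum>(q1, q2)\<leftarrow>Q. f (r1 \<cdot>\<^bsub>H\<^esub> q1) (r2 \<cdot>\<^bsub>H\<^esub> q2)) = f (one H) (one H)"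
proof -
  obtain Q where Q: "tensor2_eq (scl H) (scl H)
      [(r1 \<cdot>\<^bsub>H\<^esub> q1, r2 \<cdot>\<^bsub>H\<^esub> q2). (r1, r2) \<leftarrow> R, (q1, q2) \<leftarrow> Q] [(one H, one H)]"
    using quasitriangular by (auto simp: quasitriangular_hopf_algebra_def)
  show ?thesis
  proof (intro exI[of _ Q] allI impI)
    fix f :: "'h \<Rightarrow> 'h \<Rightarrow> 'h"
    assume "bilinear_map (scl H) (scl H) (scl H) f"
    then show "(\<Sum>(r1, r2)\<leftarrow>R. \<Sum>(q1, q2)\<leftarrow>Q. f (r1 \<cdot>\<^bsub>H\<^esub> q1) (r2 \<cdot>\<^bsub>H\<^esub> q2)) = f (one H) (one H)"
      using tensor2_eq_sum[OF Q, of "scl H" f] by (simp add: tensor_comprehension bilinear_map_def)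
  qed
qed

text \<open>Let u be the contraction of R by the counit in its first leg. Contracting R Q = 1 in the
  same way gives 1. Splitting r1 by the counit axiom and using (\<Delta> \<otimes> id) R = R13 R23
  produces an additional factor u on the left, so the same expression equals u as well.\<close>

lemma R_counit_left_one: "(\<Sum>(r1, r2)\<leftarrow>R. scl H (counit H r1) r2) = one H" (is "?u = _")
proof -
  obtain Q where Q: "\<And>f :: 'h \<Rightarrow> 'h \<Rightarrow> 'h. bilinear_map (scl H) (scl H) (scl H) f \<Longrightarrow>
    (\<Sum>(r1, r2)\<leftarrow>R. \<Sum>(q1, q2)\<leftarrow>Q. f (r1 \<cdot>\<^bsub>H\<^esub> q1) (r2 \<cdot>\<^bsub>H\<^esub> q2)) = f (one H) (one H)"
    using R_right_inverse by blast
  have "one H = (\<Sum>(r1, r2)\<leftarrow>R. \<Sum>(q1, q2)\<leftarrow>Q. scl H (counit H (r1 \<cdot>\<^bsub>H\<^esub> q1)) (r2 \<cdot>\<^bsub>H\<^esub> q2))"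
    by (rule HOL.trans[OF _ Q[of "\<lambda>x y. scl H (counit H x) y", symmetric]])
      (intro bilinear_mapI linear_intros | simp add: vs_one[OF H_vs])+
  also have "\<dots> = (\<Sum>(r1, r2)\<leftarrow>R. \<Sum>(r11, r12)\<leftarrow>comul H r1. scl H (counit H r11)
      (\<Sum>(q1, q2)\<leftarrow>Q. scl H (counit H (r12 \<cdot>\<^bsub>H\<^esub> q1)) (r2 \<cdot>\<^bsub>H\<^esub> q2)))"
    by (intro tsum_cong' H_counit(1)[symmetric, where t = "scl H"] linear_intros)
  also have "\<dots> = (\<Sum>(r1, r2)\<leftarrow>R. \<Sum>(r1', r2')\<leftarrow>R. scl H (counit H r1)
      (\<Sum>(q1, q2)\<leftarrow>Q. scl H (counit H (r1' \<cdot>\<^bsub>H\<^esub> q1)) (r2 \<cdot>\<^bsub>H\<^esub> r2' \<cdot>\<^bsub>H\<^esub> q2)))"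
    by (rule R_comul_left[where t = "scl H"]) (intro linear_intros)+
  also have "\<dots> = (\<Sum>(r1', r2')\<leftarrow>R. \<Sum>(q1, q2)\<leftarrow>Q. scl H (counit H (r1' \<cdot>\<^bsub>H\<^esub> q1)) (?u \<cdot>\<^bsub>H\<^esub> (r2' \<cdot>\<^bsub>H\<^esub> q2)))"
    apply (subst tsum_swap)
    apply (simp only: tsum_pull H_assoc tsum_swap[where s=R and t=Q])
    apply (simp only: mult.commute)
    done
  also have "\<dots> = ?u"
    by (rule HOL.trans[OF Q[of "\<lambda>x y. scl H (counit H x) (?u \<cdot>\<^bsub>H\<^esub> y)"]])
      (intro bilinear_mapI linear_intros | simp add: vs_one[OF H_vs])+
  finally show ?thesis ..
qed

text \<open>The mirror image of the preceding argument, with (id \<otimes> \<Delta>) R = R13 R12 and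
  the counit on the second leg.\<close>

lemma R_counit_right_one: "(\<Sum>(r1, r2)\<leftarrow>R. scl H (counit H r2) r1) = one H" (is "?u = _")
proof -
  obtain Q where Q: "\<And>f :: 'h \<Rightarrow> 'h \<Rightarrow> 'h. bilinear_map (scl H) (scl H) (scl H) f \<Longrightarrow>
    (\<Sum>(r1, r2)\<leftarrow>R. \<Sum>(q1, q2)\<leftarrow>Q. f (r1 \<cdot>\<^bsub>H\<^esub> q1) (r2 \<cdot>\<^bsub>H\<^esub> q2)) = f (one H) (one H)"
    using R_right_inverse by blast
  have "one H = (\<Sum>(r1, r2)\<leftarrow>R. \<Sum>(q1, q2)\<leftarrow>Q. scl H (counit H (r2 \<cdot>\<^bsub>H\<^esub> q2)) (r1 \<cdot>\<^bsub>H\<^esub> q1))"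
    by (rule HOL.trans[OF _ Q[of "\<lambda>x y. scl H (counit H y) x", symmetric]])
      (intro bilinear_mapI linear_intros | simp add: vs_one[OF H_vs])+
  also have "\<dots> = (\<Sum>(r1, r2)\<leftarrow>R. \<Sum>(r21, r22)\<leftarrow>comul H r2. scl H (counit H r22)
      (\<Sum>(q1, q2)\<leftarrow>Q. scl H (counit H (r21 \<cdot>\<^bsub>H\<^esub> q2)) (r1 \<cdot>\<^bsub>H\<^esub> q1)))"
    by (intro tsum_cong' H_counit(2)[symmetric, where t = "scl H"] linear_intros)
  also have "\<dots> = (\<Sum>(r1, r2)\<leftarrow>R. \<Sum>(r1', r2')\<leftarrow>R. scl H (counit H r2)
      (\<Sum>(q1, q2)\<leftarrow>Q. scl H (counit H (r2' \<cdot>\<^bsub>H\<^esub> q2)) (r1 \<cdot>\<^bsub>H\<^esub> r1' \<cdot>\<^bsub>H\<^esub> q1)))"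
    by (rule R_comul_right[where t = "scl H"]) (intro linear_intros)+
  also have "\<dots> = (\<Sum>(r1', r2')\<leftarrow>R. \<Sum>(q1, q2)\<leftarrow>Q. scl H (counit H (r2' \<cdot>\<^bsub>H\<^esub> q2)) (?u \<cdot>\<^bsub>H\<^esub> (r1' \<cdot>\<^bsub>H\<^esub> q1)))"
    apply (subst tsum_swap)
    apply (simp only: tsum_pull H_assoc tsum_swap[where s=R and t=Q])
    apply (simp only: mult.commute)
    done
  also have "\<dots> = ?u"
    by (rule HOL.trans[OF Q[of "\<lambda>x y. scl H (counit H y) (?u \<cdot>\<^bsub>H\<^esub> x)"]])
      (intro bilinear_mapI linear_intros | simp add: vs_one[OF H_vs])+
  finally show ?thesis ..
qed

lemma R_counit_left:
  assumes "linear_on (scl H) t f"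
  shows "(\<Sum>(r1, r2)\<leftarrow>R. t (counit H r1) (f r2)) = f (one H)"
  by (simp add: R_counit_left_one[symmetric] linear_on_sum[OF assms] linear_on_scale[OF assms])

lemma R_counit_right:
  assumes "linear_on (scl H) t f"
  shows "(\<Sum>(r1, r2)\<leftarrow>R. t (counit H r2) (f r1)) = f (one H)"
  by (simp add: R_counit_right_one[symmetric] linear_on_sum[OF assms] linear_on_scale[OF assms])

text \<open>(S \<otimes> id) R is a right inverse of R: the expression is R13 R23 with the antipode
  applied to the middle leg and the first two legs multiplied. Undoing the hexagon identity turns it
  into r11 S(r12) \<otimes> r2, and the antipode axiom leaves the counit contraction of R.\<close>

lemma R_antipode_inverse:
  assumes f: "\<And>w. linear_on (scl H) t (\<lambda>v. f v w)" "\<And>v. linear_on (scl H) t (\<lambda>w. f v w)"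
  shows "(\<Sum>(r1, r2)\<leftarrow>R. \<Sum>(r1', r2')\<leftarrow>R. f (r1 \<cdot>\<^bsub>H\<^esub> antipode H r1') (r2 \<cdot>\<^bsub>H\<^esub> r2')) = f (one H) (one H)"
proof -
  note bilinear_map_left[OF bilinear_mapI[where f=f, OF f], linear_intros]
    bilinear_map_right[OF bilinear_mapI[where f=f, OF f], linear_intros]
  have "(\<Sum>(r1, r2)\<leftarrow>R. \<Sum>(r1', r2')\<leftarrow>R. f (r1 \<cdot>\<^bsub>H\<^esub> antipode H r1') (r2 \<cdot>\<^bsub>H\<^esub> r2')) =
      (\<Sum>(r1, r2)\<leftarrow>R. \<Sum>(r11, r12)\<leftarrow>comul H r1. f (r11 \<cdot>\<^bsub>H\<^esub> antipode H r12) r2)"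
    by (rule R_comul_left[where t=t, symmetric]) (intro linear_intros)+
  also have "\<dots> = (\<Sum>(r1, r2)\<leftarrow>R. f (\<Sum>(r11, r12)\<leftarrow>comul H r1. r11 \<cdot>\<^bsub>H\<^esub> antipode H r12) r2)"
    by (simp only: linear_on_sum[OF f(1)])
  also have "\<dots> = (\<Sum>(r1, r2)\<leftarrow>R. t (counit H r1) (f (one H) r2))"
    by (simp only: H_antipode linear_on_scale[OF f(1)])
  also have "\<dots> = f (one H) (one H)"
    by (rule R_counit_left[OF f(2)])
  finally show ?thesis .
qed

end

section \<open>Braided Hopf algebras\<close>

locale braided_hopf = quasitriangular H R
  for H :: "('k::field, 'h::ab_group_add) hopf_data" and R +
  fixes B :: "('k, 'b::ab_group_add) hopf_data" and act :: "'h \<Rightarrow> 'b \<Rightarrow> 'b"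
  assumes braided: "braided_hopf_algebra H R B act"
begin

lemma B_parts: "k_algebra B" "k_coalgebra B" "counit_multiplicative B" "is_antipode B"
  and act_bilinear: "bilinear_map (scl H) (scl B) (scl B) act"
  and act_one [simp]: "act (one H) x = x"
  and act_act: "act (g \<cdot>\<^bsub>H\<^esub> h) x = act g (act h x)"
  and act_mul: "act h (x \<cdot>\<^bsub>B\<^esub> y) = (\<Sum>(h1, h2)\<leftarrow>comul H h. act h1 x \<cdot>\<^bsub>B\<^esub> act h2 y)"
  and act_unit: "act h (one B) = scl B (counit H h) (one B)"
  and counit_act: "counit B (act h x) = counit H h * counit B x"
  and antipode_act: "antipode B (act h x) = act h (antipode B x)"
  using braided by (auto simp: braided_hopf_algebra_def left_module_def)

lemmas B_vs [linear_intros] = k_algebra_vector_space[OF B_parts(1)]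
lemmas B_mul = k_algebra_mul[OF B_parts(1)]
lemmas [linear_intros] = bilinear_map_left[OF B_mul] bilinear_map_right[OF B_mul]
  bilinear_map_left[OF act_bilinear] bilinear_map_right[OF act_bilinear]
  k_coalgebra_comul_linear[OF B_parts(2)] k_coalgebra_counit_linear[OF B_parts(2)]
  antipode_linear[OF B_parts(4)]
lemmas [tsum_pull] = bilinear_map_pull[OF B_mul] bilinear_map_pull[OF act_bilinear] scale_pull[OF B_vs]
lemmas B_assoc = k_algebra_assoc[OF B_parts(1)]
lemmas B_one [simp] = k_algebra_one_left[OF B_parts(1)] k_algebra_one_right[OF B_parts(1)]
lemmas B_counit_left = k_coalgebra_counit_left[OF B_parts(2)]
lemmas B_counit_right = k_coalgebra_counit_right[OF B_parts(2)]
lemmas B_antipode_left = antipode_left[OF B_parts(4)]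
lemmas B_antipode_right = antipode_right[OF B_parts(4)]

lemma counit_B [simp]: "counit B (x \<cdot>\<^bsub>B\<^esub> y) = counit B x * counit B y" "counit B (one B) = 1"
  using B_parts(3) by (auto simp: counit_multiplicative_def)

lemma antipode_B_linear: "linear_on (scl B) (scl B) (antipode B)"
  by (intro linear_intros)

lemma antipode_unit [simp]: "antipode B (one B) = one B"
  using antipode_one[OF B_parts(1,4,3)] braided by (simp add: braided_hopf_algebra_def)

lemma comul_act:
  assumes "\<And>w. linear_on (scl B) t (\<lambda>v. f v w)" "\<And>v. linear_on (scl B) t (\<lambda>w. f v w)"
  shows "(\<Sum>(z1, z2)\<leftarrow>comul B (act h x). f z1 z2) =
    (\<Sum>(h1, h2)\<leftarrow>comul H h. \<Sum>(x1, x2)\<leftarrow>comul B x. f (act h1 x1) (act h2 x2))"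
  using braided tensor2_eq_sum[OF _ assms, of "comul B (act h x)"
      "[(act h1 x1, act h2 x2). (h1, h2) \<leftarrow> comul H h, (x1, x2) \<leftarrow> comul B x]"]
  by (simp add: braided_hopf_algebra_def tensor_comprehension)

lemma comul_mul_B:
  assumes "\<And>w. linear_on (scl B) t (\<lambda>v. f v w)" "\<And>v. linear_on (scl B) t (\<lambda>w. f v w)"
  shows "(\<Sum>(z1, z2)\<leftarrow>comul B (x \<cdot>\<^bsub>B\<^esub> y). f z1 z2) =
    (\<Sum>(x1, x2)\<leftarrow>comul B x. \<Sum>(y1, y2)\<leftarrow>comul B y. \<Sum>(r1, r2)\<leftarrow>R.
       f (x1 \<cdot>\<^bsub>B\<^esub> act r2 y1) (act r1 x2 \<cdot>\<^bsub>B\<^esub> y2))"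
  using braided tensor2_eq_sum[OF _ assms, of "comul B (x \<cdot>\<^bsub>B\<^esub> y)"
      "[(x1 \<cdot>\<^bsub>B\<^esub> act r2 y1, act r1 x2 \<cdot>\<^bsub>B\<^esub> y2).
                 (x1, x2) \<leftarrow> comul B x, (y1, y2) \<leftarrow> comul B y, (r1, r2) \<leftarrow> R]"]
  by (simp add: braided_hopf_algebra_def tensor_comprehension)

text \<open>Convolution with respect to the coproduct of the braided tensor square of \<open>B\<close>.\<close>

definition bconv :: "('b \<Rightarrow> 'b \<Rightarrow> 'b) \<Rightarrow> ('b \<Rightarrow> 'b \<Rightarrow> 'b) \<Rightarrow> 'b \<Rightarrow> 'b \<Rightarrow> 'b" where
  "bconv f g x y = (\<Sum>(x1, x2)\<leftarrow>comul B x. \<Sum>(y1, y2)\<leftarrow>comul B y. \<Sum>(r1, r2)\<leftarrow>R.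
     f x1 (act r2 y1) \<cdot>\<^bsub>B\<^esub> g (act r1 x2) y2)"

text \<open>The braided tensor square of B is a coassociative coalgebra. On one side a coproduct
  falls on R^(2) and on the other on R^(1); the two hexagon identities resolve both into the same
  arrangement of three R-matrices.\<close>

lemma bconv_assoc:
  assumes f: "bilinear_map (scl B) (scl B) (scl B) f" and g: "bilinear_map (scl B) (scl B) (scl B) g"
    and h: "bilinear_map (scl B) (scl B) (scl B) h"
  shows "bconv (bconv f g) h x y = bconv f (bconv g h) x y"
proof -
  note [linear_intros] = bilinear_map_left[OF f] bilinear_map_right[OF f] bilinear_map_left[OF g]
    bilinear_map_right[OF g] bilinear_map_left[OF h] bilinear_map_right[OF h]
  \<comment> \<open>The common normal form of both bracketings. Its R-matrices a, b and c record the
    crossings of \<open>u2\<close> with \<open>v1\<close>, of \<open>u3\<close> with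
    \<open>v1\<close> and of \<open>u3\<close> with \<open>v2\<close>.\<close>
  define \<Psi> where "\<Psi> u1 u2 u3 v1 v2 v3 = (\<Sum>(a1, a2)\<leftarrow>R. \<Sum>(b1, b2)\<leftarrow>R. \<Sum>(c1, c2)\<leftarrow>R.
    f u1 (act a2 (act b2 v1)) \<cdot>\<^bsub>B\<^esub> (g (act a1 u2) (act c2 v2) \<cdot>\<^bsub>B\<^esub> h (act c1 (act b1 u3)) v3))"
    for u1 u2 u3 v1 v2 v3
  have "bconv (bconv f g) h x y =
     (\<Sum>(x1, x2)\<leftarrow>comul B x. \<Sum>(y1, y2)\<leftarrow>comul B y. \<Sum>(r1, r2)\<leftarrow>R.
       (\<Sum>(x11, x12)\<leftarrow>comul B x1. \<Sum>(w1, w2)\<leftarrow>comul B (act r2 y1). \<Sum>(a1, a2)\<leftarrow>R.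
          f x11 (act a2 w1) \<cdot>\<^bsub>B\<^esub> g (act a1 x12) w2) \<cdot>\<^bsub>B\<^esub> h (act r1 x2) y2)"
    by (simp only: bconv_def)
  also have "\<dots> =
     (\<Sum>(x1, x2)\<leftarrow>comul B x. \<Sum>(y1, y2)\<leftarrow>comul B y. \<Sum>(r1, r2)\<leftarrow>R.
       \<Sum>(x11, x12)\<leftarrow>comul B x1. \<Sum>(w1, w2)\<leftarrow>comul B (act r2 y1). \<Sum>(a1, a2)\<leftarrow>R.
          f x11 (act a2 w1) \<cdot>\<^bsub>B\<^esub> g (act a1 x12) w2 \<cdot>\<^bsub>B\<^esub> h (act r1 x2) y2)"
    by (simp only: tsum_pull)
  also have "\<dots> =
     (\<Sum>(x1, x2)\<leftarrow>comul B x. \<Sum>(y1, y2)\<leftarrow>comul B y. \<Sum>(r1, r2)\<leftarrow>R. \<Sum>(x11, x12)\<leftarrow>comul B x1.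
       \<Sum>(r21, r22)\<leftarrow>comul H r2. \<Sum>(y11, y12)\<leftarrow>comul B y1. \<Sum>(a1, a2)\<leftarrow>R.
          f x11 (act a2 (act r21 y11)) \<cdot>\<^bsub>B\<^esub> g (act a1 x12) (act r22 y12) \<cdot>\<^bsub>B\<^esub> h (act r1 x2) y2)"
    by (intro tsum_cong' comul_act[where t = "scl B"] linear_intros)
  also have "\<dots> =
     (\<Sum>(x1, x2)\<leftarrow>comul B x. \<Sum>(y1, y2)\<leftarrow>comul B y. \<Sum>(x11, x12)\<leftarrow>comul B x1. \<Sum>(y11, y12)\<leftarrow>comul B y1.
       \<Sum>(r1, r2)\<leftarrow>R. \<Sum>(r21, r22)\<leftarrow>comul H r2. \<Sum>(a1, a2)\<leftarrow>R.
          f x11 (act a2 (act r21 y11)) \<cdot>\<^bsub>B\<^esub> g (act a1 x12) (act r22 y12) \<cdot>\<^bsub>B\<^esub> h (act r1 x2) y2)"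
    by (simp only: tsum_swap[where s=R and t="comul B u" for u]
      tsum_swap[where s="comul H v" and t="comul B u" for u v])
  also have "\<dots> =
     (\<Sum>(x1, x2)\<leftarrow>comul B x. \<Sum>(y1, y2)\<leftarrow>comul B y. \<Sum>(x11, x12)\<leftarrow>comul B x1. \<Sum>(y11, y12)\<leftarrow>comul B y1.
       \<Sum>(r1, r2)\<leftarrow>R. \<Sum>(r1', r2')\<leftarrow>R. \<Sum>(a1, a2)\<leftarrow>R.
          f x11 (act a2 (act r2' y11)) \<cdot>\<^bsub>B\<^esub> g (act a1 x12) (act r2 y12) \<cdot>\<^bsub>B\<^esub> h (act (r1 \<cdot>\<^bsub>H\<^esub> r1') x2) y2)"
    by (intro tsum_cong' R_comul_right[where t = "scl B"] linear_intros)
  also have "\<dots> =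
     (\<Sum>(x1, x2)\<leftarrow>comul B x. \<Sum>(y1, y2)\<leftarrow>comul B y. \<Sum>(x11, x12)\<leftarrow>comul B x1. \<Sum>(y11, y12)\<leftarrow>comul B y1.
       \<Psi> x11 x12 x2 y11 y12 y2)"
    unfolding \<Psi>_def B_assoc act_act
    by (rule tsum_cong', rule tsum_cong', rule tsum_cong', rule tsum_cong', rule tsum_reverse)
  finally have L: "bconv (bconv f g) h x y = (\<Sum>(x1, x2)\<leftarrow>comul B x. \<Sum>(y1, y2)\<leftarrow>comul B y.
      \<Sum>(x11, x12)\<leftarrow>comul B x1. \<Sum>(y11, y12)\<leftarrow>comul B y1. \<Psi> x11 x12 x2 y11 y12 y2)" .
  have \<Psi>: "linear_on (scl B) (scl B) (\<lambda>u. \<Psi> u u2 u3 v1 v2 v3)" "linear_on (scl B) (scl B) (\<lambda>u. \<Psi> u1 u u3 v1 v2 v3)"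
    "linear_on (scl B) (scl B) (\<lambda>u. \<Psi> u1 u2 u v1 v2 v3)" "linear_on (scl B) (scl B) (\<lambda>u. \<Psi> u1 u2 u3 u v2 v3)"
    "linear_on (scl B) (scl B) (\<lambda>u. \<Psi> u1 u2 u3 v1 u v3)" "linear_on (scl B) (scl B) (\<lambda>u. \<Psi> u1 u2 u3 v1 v2 u)"
    for u1 u2 u3 v1 v2 v3 unfolding \<Psi>_def by (intro linear_intros)+
  have "bconv f (bconv g h) x y =
     (\<Sum>(x1, x2)\<leftarrow>comul B x. \<Sum>(y1, y2)\<leftarrow>comul B y. \<Sum>(r1, r2)\<leftarrow>R. f x1 (act r2 y1) \<cdot>\<^bsub>B\<^esub>
       (\<Sum>(z1, z2)\<leftarrow>comul B (act r1 x2). \<Sum>(y21, y22)\<leftarrow>comul B y2. \<Sum>(c1, c2)\<leftarrow>R.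
          g z1 (act c2 y21) \<cdot>\<^bsub>B\<^esub> h (act c1 z2) y22))"
    by (simp only: bconv_def)
  also have "\<dots> =
     (\<Sum>(x1, x2)\<leftarrow>comul B x. \<Sum>(y1, y2)\<leftarrow>comul B y. \<Sum>(r1, r2)\<leftarrow>R. f x1 (act r2 y1) \<cdot>\<^bsub>B\<^esub>
       (\<Sum>(r11, r12)\<leftarrow>comul H r1. \<Sum>(x21, x22)\<leftarrow>comul B x2. \<Sum>(y21, y22)\<leftarrow>comul B y2. \<Sum>(c1, c2)\<leftarrow>R.
          g (act r11 x21) (act c2 y21) \<cdot>\<^bsub>B\<^esub> h (act c1 (act r12 x22)) y22))"
    by (intro tsum_cong' arg_cong[where f="mul B u" for u] comul_act[where t = "scl B"] linear_intros)
  also have "\<dots> =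
     (\<Sum>(x1, x2)\<leftarrow>comul B x. \<Sum>(y1, y2)\<leftarrow>comul B y. \<Sum>(x21, x22)\<leftarrow>comul B x2. \<Sum>(y21, y22)\<leftarrow>comul B y2.
       \<Sum>(r1, r2)\<leftarrow>R. \<Sum>(r11, r12)\<leftarrow>comul H r1. \<Sum>(c1, c2)\<leftarrow>R. f x1 (act r2 y1) \<cdot>\<^bsub>B\<^esub>
          (g (act r11 x21) (act c2 y21) \<cdot>\<^bsub>B\<^esub> h (act c1 (act r12 x22)) y22))"
    by (simp only: tsum_pull tsum_swap[where s=R and t="comul B u" for u]
      tsum_swap[where s="comul H v" and t="comul B u" for u v])
  also have "\<dots> =
     (\<Sum>(x1, x2)\<leftarrow>comul B x. \<Sum>(y1, y2)\<leftarrow>comul B y. \<Sum>(x21, x22)\<leftarrow>comul B x2. \<Sum>(y21, y22)\<leftarrow>comul B y2.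
       \<Sum>(a1, a2)\<leftarrow>R. \<Sum>(b1, b2)\<leftarrow>R. \<Sum>(c1, c2)\<leftarrow>R. f x1 (act (a2 \<cdot>\<^bsub>H\<^esub> b2) y1) \<cdot>\<^bsub>B\<^esub>
          (g (act a1 x21) (act c2 y21) \<cdot>\<^bsub>B\<^esub> h (act c1 (act b1 x22)) y22))"
    by (intro tsum_cong' R_comul_left[where t = "scl B"] linear_intros)
  also have "\<dots> =
     (\<Sum>(x1, x2)\<leftarrow>comul B x. \<Sum>(y1, y2)\<leftarrow>comul B y. \<Sum>(x21, x22)\<leftarrow>comul B x2. \<Sum>(y21, y22)\<leftarrow>comul B y2.
       \<Psi> x1 x21 x22 y1 y21 y22)"
    by (simp only: \<Psi>_def act_act)
  also have "\<dots> = bconv (bconv f g) h x y"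
    unfolding L by (rule k_coalgebra_coassoc2[OF B_parts(2), where t="scl B", symmetric]) (rule \<Psi>)+
  finally show ?thesis ..
qed

text \<open>Uniqueness of convolution inverses: with respect to \<open>bconv\<close>, the map
  \<open>L\<close> is a left inverse and \<open>N\<close> a right inverse of the multiplication,
  with unit \<open>E\<close>. Hence L = L * (mul * N) = (L * mul) * N = N.\<close>

lemma antipode_mul:
  "antipode B (x \<cdot>\<^bsub>B\<^esub> y) = (\<Sum>(r1, r2)\<leftarrow>R. act r2 (antipode B y) \<cdot>\<^bsub>B\<^esub> act r1 (antipode B x))"
proof -
  define N where "N x y = (\<Sum>(r1, r2)\<leftarrow>R. act r2 (antipode B y) \<cdot>\<^bsub>B\<^esub> act r1 (antipode B x))" for x y
  define L where "L x y = antipode B (x \<cdot>\<^bsub>B\<^esub> y)" for x y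
  define E where "E x y = scl B (counit B x * counit B y) (one B)" for x y
  have N: "bilinear_map (scl B) (scl B) (scl B) N" and L: "bilinear_map (scl B) (scl B) (scl B) L"
    and E: "bilinear_map (scl B) (scl B) (scl B) E"
    unfolding N_def L_def E_def by (intro bilinear_mapI linear_intros)+
  note [linear_intros] = bilinear_map_left[OF N] bilinear_map_right[OF N] bilinear_map_left[OF L]
    bilinear_map_right[OF L]
  have LM: "bconv L (mul B) x y = E x y" for x y
  proof -
    have "bconv L (mul B) x y = (\<Sum>(z1, z2)\<leftarrow>comul B (x \<cdot>\<^bsub>B\<^esub> y). antipode B z1 \<cdot>\<^bsub>B\<^esub> z2)"
      unfolding bconv_def L_def by (rule comul_mul_B[where t="scl B", symmetric]) (intro linear_intros)+
    then show ?thesis by (simp add: B_antipode_left E_def)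
  qed
  have MN: "bconv (mul B) N x y = E x y" for x y
  proof -
    have "bconv (mul B) N x y = (\<Sum>(x1, x2)\<leftarrow>comul B x. \<Sum>(y1, y2)\<leftarrow>comul B y. \<Sum>(r1, r2)\<leftarrow>R. \<Sum>(r1', r2')\<leftarrow>R.
        x1 \<cdot>\<^bsub>B\<^esub> (act r2 y1 \<cdot>\<^bsub>B\<^esub> act r2' (antipode B y2) \<cdot>\<^bsub>B\<^esub> act (r1' \<cdot>\<^bsub>H\<^esub> r1) (antipode B x2)))"
      by (simp only: bconv_def N_def tsum_pull B_assoc antipode_act act_act)
    also have "\<dots> = (\<Sum>(x1, x2)\<leftarrow>comul B x. \<Sum>(y1, y2)\<leftarrow>comul B y. \<Sum>(r1', r2')\<leftarrow>R. \<Sum>(r1, r2)\<leftarrow>R.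
        x1 \<cdot>\<^bsub>B\<^esub> (act r2 y1 \<cdot>\<^bsub>B\<^esub> act r2' (antipode B y2) \<cdot>\<^bsub>B\<^esub> act (r1' \<cdot>\<^bsub>H\<^esub> r1) (antipode B x2)))"
      by (rule tsum_cong', rule tsum_cong', rule tsum_swap)
    \<comment> \<open>The two R-matrices merge into (id \<otimes> \<Delta>) R. By
      \<open>act_mul\<close> its second leg then acts on the whole product of y1 and S(y2), where
      the antipode axiom applies.\<close>
    also have "\<dots> = (\<Sum>(x1, x2)\<leftarrow>comul B x. \<Sum>(y1, y2)\<leftarrow>comul B y. \<Sum>(r1, r2)\<leftarrow>R. \<Sum>(r21, r22)\<leftarrow>comul H r2.
        x1 \<cdot>\<^bsub>B\<^esub> (act r21 y1 \<cdot>\<^bsub>B\<^esub> act r22 (antipode B y2) \<cdot>\<^bsub>B\<^esub> act r1 (antipode B x2)))"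
      by (rule tsum_cong', rule tsum_cong', rule R_comul_right[where t="scl B", symmetric]) (intro linear_intros)+
    also have "\<dots> = (\<Sum>(x1, x2)\<leftarrow>comul B x. \<Sum>(y1, y2)\<leftarrow>comul B y. \<Sum>(r1, r2)\<leftarrow>R.
        x1 \<cdot>\<^bsub>B\<^esub> (act r2 (y1 \<cdot>\<^bsub>B\<^esub> antipode B y2) \<cdot>\<^bsub>B\<^esub> act r1 (antipode B x2)))"
      by (simp only: act_mul tsum_pull)
    also have "\<dots> = (\<Sum>(x1, x2)\<leftarrow>comul B x. \<Sum>(r1, r2)\<leftarrow>R.
        x1 \<cdot>\<^bsub>B\<^esub> (act r2 (\<Sum>(y1, y2)\<leftarrow>comul B y. y1 \<cdot>\<^bsub>B\<^esub> antipode B y2) \<cdot>\<^bsub>B\<^esub> act r1 (antipode B x2)))"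
      by (simp only: tsum_pull tsum_swap[where s=R and t="comul B u" for u])
    also have "\<dots> = (\<Sum>(x1, x2)\<leftarrow>comul B x. scl B (counit B y) (\<Sum>(r1, r2)\<leftarrow>R. scl B (counit H r2)
        (x1 \<cdot>\<^bsub>B\<^esub> act r1 (antipode B x2))))"
      by (simp only: B_antipode_right tsum_pull act_unit B_one)
    also have "\<dots> = (\<Sum>(x1, x2)\<leftarrow>comul B x. scl B (counit B y) (x1 \<cdot>\<^bsub>B\<^esub> antipode B x2))"
      by (subst R_counit_right[where t="scl B"]) (intro linear_intros, simp)
    also have "\<dots> = scl B (counit B y) (\<Sum>(x1, x2)\<leftarrow>comul B x. x1 \<cdot>\<^bsub>B\<^esub> antipode B x2)"
      by (simp only: tsum_pull)
    also have "\<dots> = E x y" by (simp only: B_antipode_right tsum_pull E_def mult.commute)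
    finally show ?thesis .
  qed
  \<comment> \<open>Neutrality of \<open>E\<close>: since the counit of B is H-linear, the R-matrix
    next to it is contracted by the counit of H and disappears. \<open>LE\<close> is the mirror
    case.\<close>
  have EN: "bconv E N x y = N x y" for x y
  proof -
    have "bconv E N x y = (\<Sum>(x1, x2)\<leftarrow>comul B x. \<Sum>(y1, y2)\<leftarrow>comul B y. \<Sum>(r1, r2)\<leftarrow>R.
        scl B (counit B x1) (scl B (counit B y1) (scl B (counit H r2) (N (act r1 x2) y2))))"
      by (simp only: bconv_def E_def tsum_pull B_one counit_act) (simp only: ac_simps)
    also have "\<dots> = (\<Sum>(x1, x2)\<leftarrow>comul B x. \<Sum>(y1, y2)\<leftarrow>comul B y. 
        scl B (counit B x1) (scl B (counit B y1) (\<Sum>(r1, r2)\<leftarrow>R. scl B (counit H r2) (N (act r1 x2) y2))))"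
      by (simp only: tsum_pull)
    also have "\<dots> = (\<Sum>(x1, x2)\<leftarrow>comul B x. \<Sum>(y1, y2)\<leftarrow>comul B y. 
        scl B (counit B x1) (scl B (counit B y1) (N x2 y2)))"
      by (intro tsum_cong', subst R_counit_right[where t="scl B"]) (intro linear_intros, simp)
    also have "\<dots> = (\<Sum>(x1, x2)\<leftarrow>comul B x. scl B (counit B x1)
        (\<Sum>(y1, y2)\<leftarrow>comul B y. scl B (counit B y1) (N x2 y2)))"
      by (simp only: tsum_pull)
    also have "\<dots> = (\<Sum>(x1, x2)\<leftarrow>comul B x. scl B (counit B x1) (N x2 y))"
      by (intro tsum_cong' arg_cong[where f="scl B u" for u] B_counit_left linear_intros)
    also have "\<dots> = N x y"
      by (rule B_counit_left) (intro linear_intros)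
    finally show ?thesis .
  qed
  have LE: "bconv L E x y = L x y" for x y
  proof -
    have "bconv L E x y = (\<Sum>(x1, x2)\<leftarrow>comul B x. \<Sum>(y1, y2)\<leftarrow>comul B y. \<Sum>(r1, r2)\<leftarrow>R.
        scl B (counit B x2) (scl B (counit B y2) (scl B (counit H r1) (L x1 (act r2 y1)))))"
      by (simp only: bconv_def E_def tsum_pull B_one counit_act) (simp only: ac_simps)
    also have "\<dots> = (\<Sum>(x1, x2)\<leftarrow>comul B x. \<Sum>(y1, y2)\<leftarrow>comul B y. 
        scl B (counit B x2) (scl B (counit B y2) (\<Sum>(r1, r2)\<leftarrow>R. scl B (counit H r1) (L x1 (act r2 y1)))))"
      by (simp only: tsum_pull)
    also have "\<dots> = (\<Sum>(x1, x2)\<leftarrow>comul B x. \<Sum>(y1, y2)\<leftarrow>comul B y. 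
        scl B (counit B x2) (scl B (counit B y2) (L x1 y1)))"
      by (intro tsum_cong', subst R_counit_left[where t="scl B"]) (intro linear_intros, simp)
    also have "\<dots> = (\<Sum>(x1, x2)\<leftarrow>comul B x. scl B (counit B x2)
        (\<Sum>(y1, y2)\<leftarrow>comul B y. scl B (counit B y2) (L x1 y1)))"
      by (simp only: tsum_pull)
    also have "\<dots> = (\<Sum>(x1, x2)\<leftarrow>comul B x. scl B (counit B x2) (L x1 y))"
      by (intro tsum_cong' arg_cong[where f="scl B u" for u] B_counit_right linear_intros)
    also have "\<dots> = L x y"
      by (rule B_counit_right) (intro linear_intros)
    finally show ?thesis .
  qed
  have "L x y = bconv L (bconv (mul B) N) x y" 
    using LE by (simp add: MN bconv_def[of L "bconv (mul B) N"] bconv_def[of L E])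
  also have "\<dots> = bconv (bconv L (mul B)) N x y"
    by (rule bconv_assoc[OF L B_mul N, symmetric])
  also have "\<dots> = N x y"
    using EN by (simp add: LM bconv_def[of "bconv L (mul B)" N] bconv_def[of E N])
  finally show ?thesis unfolding L_def N_def .
qed

section \<open>The inverse of a braided antipode\<close>

context
  assumes bij: "bij (antipode B)"
begin

lemma inv_antipode [simp]: "antipode B (inv (antipode B) x) = x" "inv (antipode B) (antipode B x) = x"
  using bij by (simp_all add: bij_is_surj surj_f_inv_f bij_is_inj)

lemma inv_antipode_linear: "linear_on (scl B) (scl B) (inv (antipode B))"
  by (intro linear_onI B_vs; rule injD[OF bij_is_inj[OF bij]])
    (simp_all add: linear_on_add[OF antipode_B_linear] linear_on_scale[OF antipode_B_linear])

text \<open>It is enough to compare the images under the injective antipode. There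
  \<open>antipode_mul\<close> reverses the factors and introduces a second R-matrix, which cancels
  against (S \<otimes> id) R. What remains is S(b1) b2. The identity is the core of
  \<open>\<omega> * \<sigma> = \<epsilon> \<otimes> \<epsilon>\<close>.\<close>

lemma braided_inverse_left:
  "(\<Sum>(b1, b2)\<leftarrow>comul B b. \<Sum>(r1, r2)\<leftarrow>R. act (antipode H r1) (inv (antipode B) b2) \<cdot>\<^bsub>B\<^esub> act r2 b1) =
   scl B (counit B b) (one B)"
proof (rule injD[OF bij_is_inj[OF bij]])
  have "antipode B (\<Sum>(b1, b2)\<leftarrow>comul B b. \<Sum>(r1, r2)\<leftarrow>R. act (antipode H r1) (inv (antipode B) b2) \<cdot>\<^bsub>B\<^esub> act r2 b1) =
    (\<Sum>(b1, b2)\<leftarrow>comul B b. \<Sum>(r1, r2)\<leftarrow>R. \<Sum>(r1', r2')\<leftarrow>R.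
      act (r2' \<cdot>\<^bsub>H\<^esub> r2) (antipode B b1) \<cdot>\<^bsub>B\<^esub> act (r1' \<cdot>\<^bsub>H\<^esub> antipode H r1) b2)"
    by (simp only: linear_on_sum[OF antipode_B_linear] antipode_mul antipode_act act_act inv_antipode)
  also have "\<dots> = (\<Sum>(b1, b2)\<leftarrow>comul B b. \<Sum>(r1', r2')\<leftarrow>R. \<Sum>(r1, r2)\<leftarrow>R.
      act (r2' \<cdot>\<^bsub>H\<^esub> r2) (antipode B b1) \<cdot>\<^bsub>B\<^esub> act (r1' \<cdot>\<^bsub>H\<^esub> antipode H r1) b2)"
    by (rule tsum_cong', rule tsum_swap)
  also have "\<dots> = (\<Sum>(b1, b2)\<leftarrow>comul B b. antipode B b1 \<cdot>\<^bsub>B\<^esub> b2)"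
    by (rule tsum_cong', subst R_antipode_inverse[where t="scl B" and
        f="\<lambda>u v. act v (antipode B x) \<cdot>\<^bsub>B\<^esub> act u y" for x y])
      (intro linear_intros | simp)+
  also have "\<dots> = antipode B (scl B (counit B b) (one B))"
    by (simp add: B_antipode_left linear_on_scale[OF antipode_B_linear])
  finally show "antipode B (\<Sum>(b1, b2)\<leftarrow>comul B b. \<Sum>(r1, r2)\<leftarrow>R.
    act (antipode H r1) (inv (antipode B) b2) \<cdot>\<^bsub>B\<^esub> act r2 b1) = antipode B (scl B (counit B b) (one B))" .
qed

text \<open>The same computation ends in b1 S(b2), because the inverse antipode now sits on the
  first leg. It serves the product of \<open>\<sigma>\<close> and \<open>\<omega>\<close> in the
  other order.\<close>

lemma braided_inverse_right:
  "(\<Sum>(b1, b2)\<leftarrow>comul B b. \<Sum>(r1, r2)\<leftarrow>R. act (antipode H r1) b2 \<cdot>\<^bsub>B\<^esub> act r2 (inv (antipode B) b1)) =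
   scl B (counit B b) (one B)"
proof (rule injD[OF bij_is_inj[OF bij]])
  have "antipode B (\<Sum>(b1, b2)\<leftarrow>comul B b. \<Sum>(r1, r2)\<leftarrow>R. act (antipode H r1) b2 \<cdot>\<^bsub>B\<^esub> act r2 (inv (antipode B) b1)) =
    (\<Sum>(b1, b2)\<leftarrow>comul B b. \<Sum>(r1, r2)\<leftarrow>R. \<Sum>(r1', r2')\<leftarrow>R.
      act (r2' \<cdot>\<^bsub>H\<^esub> r2) b1 \<cdot>\<^bsub>B\<^esub> act (r1' \<cdot>\<^bsub>H\<^esub> antipode H r1) (antipode B b2))"
    by (simp only: linear_on_sum[OF antipode_B_linear] antipode_mul antipode_act act_act inv_antipode)
  also have "\<dots> = (\<Sum>(b1, b2)\<leftarrow>comul B b. \<Sum>(r1', r2')\<leftarrow>R. \<Sum>(r1, r2)\<leftarrow>R.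
      act (r2' \<cdot>\<^bsub>H\<^esub> r2) b1 \<cdot>\<^bsub>B\<^esub> act (r1' \<cdot>\<^bsub>H\<^esub> antipode H r1) (antipode B b2))"
    by (rule tsum_cong', rule tsum_swap)
  also have "\<dots> = (\<Sum>(b1, b2)\<leftarrow>comul B b. b1 \<cdot>\<^bsub>B\<^esub> antipode B b2)"
    by (rule tsum_cong', subst R_antipode_inverse[where t="scl B" and
        f="\<lambda>u v. act v x \<cdot>\<^bsub>B\<^esub> act u y" for x y])
      (intro linear_intros | simp)+
  also have "\<dots> = antipode B (scl B (counit B b) (one B))"
    by (simp add: B_antipode_right linear_on_scale[OF antipode_B_linear])
  finally show "antipode B (\<Sum>(b1, b2)\<leftarrow>comul B b. \<Sum>(r1, r2)\<leftarrow>R.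
    act (antipode H r1) b2 \<cdot>\<^bsub>B\<^esub> act r2 (inv (antipode B) b1)) = antipode B (scl B (counit B b) (one B))" .
qed

end

end

section \<open>Convolution actions of bilinear forms on a coalgebra\<close>

text \<open>The target scaling \<open>t\<close> is a parameter. For the multiplication of the field
  this is the convolution product of bilinear forms on D; for a general space it is the left action
  of such forms on D-bilinear expressions.\<close>

definition lconv :: "('k::field, 'd::ab_group_add) hopf_data \<Rightarrow> ('k \<Rightarrow> 'x::ab_group_add \<Rightarrow> 'x) \<Rightarrow>
    ('d \<Rightarrow> 'd \<Rightarrow> 'k) \<Rightarrow> ('d \<Rightarrow> 'd \<Rightarrow> 'x) \<Rightarrow> 'd \<Rightarrow> 'd \<Rightarrow> 'x" where
  "lconv D t f G x y = (\<Sum>(x1, x2)\<leftarrow>comul D x. \<Sum>(y1, y2)\<leftarrow>comul D y. t (f x1 y1) (G x2 y2))"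

definition rconv :: "('k::field, 'd::ab_group_add) hopf_data \<Rightarrow> ('k \<Rightarrow> 'x::ab_group_add \<Rightarrow> 'x) \<Rightarrow>
    ('d \<Rightarrow> 'd \<Rightarrow> 'x) \<Rightarrow> ('d \<Rightarrow> 'd \<Rightarrow> 'k) \<Rightarrow> 'd \<Rightarrow> 'd \<Rightarrow> 'x" where
  "rconv D t G f x y = (\<Sum>(x1, x2)\<leftarrow>comul D x. \<Sum>(y1, y2)\<leftarrow>comul D y. t (f x2 y2) (G x1 y1))"

text \<open>Exchanging the arguments lets results on linearity in the first argument be reused for
  the second.\<close>

lemma lconv_flip: "lconv D t f G x y = lconv D t (\<lambda>x y. f y x) (\<lambda>x y. G y x) y x"
  unfolding lconv_def by (rule tsum_swap)

lemma rconv_flip: "rconv D t G f x y = rconv D t (\<lambda>x y. G y x) (\<lambda>x y. f y x) y x"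
  unfolding rconv_def by (rule tsum_swap)

locale coalgebra_pairings =
  fixes D :: "('k::field, 'd::ab_group_add) hopf_data" and t :: "'k \<Rightarrow> 'x::ab_group_add \<Rightarrow> 'x"
    and G :: "'d \<Rightarrow> 'd \<Rightarrow> 'x" and f g :: "'d \<Rightarrow> 'd \<Rightarrow> 'k"
  assumes D: "k_coalgebra D" and t [linear_intros]: "vector_space t"
    and G: "bilinear_map (scl D) (scl D) t G"
    and f: "bilinear_map (scl D) (scl D) (*) f" and g: "bilinear_map (scl D) (scl D) (*) g"
begin

lemmas [linear_intros] = k_coalgebra_vector_space[OF D] k_coalgebra_comul_linear[OF D]
  k_coalgebra_counit_linear[OF D]
  bilinear_map_left[OF G] bilinear_map_right[OF G]
  bilinear_map_left[OF f] bilinear_map_right[OF f] bilinear_map_left[OF g] bilinear_map_right[OF g]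

lemmas [tsum_pull] = scale_pull[OF t]

lemma lconv_bilinear: "bilinear_map (scl D) (scl D) t (lconv D t f G)"
  unfolding lconv_def by (intro bilinear_mapI linear_intros)

lemma rconv_bilinear: "bilinear_map (scl D) (scl D) t (rconv D t G f)"
  unfolding rconv_def by (intro bilinear_mapI linear_intros)

section \<open>Bimodule laws of the convolution actions\<close>

lemma lconv_lconv: "lconv D t f (lconv D t g G) x y = lconv D t (lconv D (*) f g) G x y"
proof -
  have "lconv D t f (lconv D t g G) x y =
    (\<Sum>(x1, x2)\<leftarrow>comul D x. \<Sum>(y1, y2)\<leftarrow>comul D y. \<Sum>(x21, x22)\<leftarrow>comul D x2. \<Sum>(y21, y22)\<leftarrow>comul D y2.
      t (f x1 y1 * g x21 y21) (G x22 y22))"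
    by (simp only: lconv_def tsum_pull)
  also have "\<dots> =
    (\<Sum>(x1, x2)\<leftarrow>comul D x. \<Sum>(y1, y2)\<leftarrow>comul D y. \<Sum>(x11, x12)\<leftarrow>comul D x1. \<Sum>(y11, y12)\<leftarrow>comul D y1.
      t (f x11 y11 * g x12 y12) (G x2 y2))"
    by (rule k_coalgebra_coassoc2[OF D, where t=t, symmetric]) (intro linear_intros)+
  also have "\<dots> = lconv D t (lconv D (*) f g) G x y"
    by (simp only: lconv_def tsum_pull)
  finally show ?thesis .
qed

lemma rconv_rconv: "rconv D t (rconv D t G f) g x y = rconv D t G (lconv D (*) f g) x y"
proof -
  have "rconv D t (rconv D t G f) g x y =
    (\<Sum>(x1, x2)\<leftarrow>comul D x. \<Sum>(y1, y2)\<leftarrow>comul D y. \<Sum>(x11, x12)\<leftarrow>comul D x1. \<Sum>(y11, y12)\<leftarrow>comul D y1.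
      t (f x12 y12 * g x2 y2) (G x11 y11))"
    by (simp only: rconv_def tsum_pull mult.commute)
  also have "\<dots> =
    (\<Sum>(x1, x2)\<leftarrow>comul D x. \<Sum>(y1, y2)\<leftarrow>comul D y. \<Sum>(x21, x22)\<leftarrow>comul D x2. \<Sum>(y21, y22)\<leftarrow>comul D y2.
      t (f x21 y21 * g x22 y22) (G x1 y1))"
    by (rule k_coalgebra_coassoc2[OF D, where t=t]) (intro linear_intros)+
  also have "\<dots> = rconv D t G (lconv D (*) f g) x y"
    by (simp only: lconv_def rconv_def tsum_pull)
  finally show ?thesis .
qed

lemma lconv_rconv: "rconv D t (lconv D t f G) g x y = lconv D t f (rconv D t G g) x y"
proof -
  have "rconv D t (lconv D t f G) g x y =
    (\<Sum>(x1, x2)\<leftarrow>comul D x. \<Sum>(y1, y2)\<leftarrow>comul D y. \<Sum>(x11, x12)\<leftarrow>comul D x1. \<Sum>(y11, y12)\<leftarrow>comul D y1.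
      t (f x11 y11 * g x2 y2) (G x12 y12))"
    by (simp only: rconv_def lconv_def tsum_pull mult.commute)
  also have "\<dots> =
    (\<Sum>(x1, x2)\<leftarrow>comul D x. \<Sum>(y1, y2)\<leftarrow>comul D y. \<Sum>(x21, x22)\<leftarrow>comul D x2. \<Sum>(y21, y22)\<leftarrow>comul D y2.
      t (f x1 y1 * g x22 y22) (G x21 y21))"
    by (rule k_coalgebra_coassoc2[OF D, where t=t]) (intro linear_intros)+
  also have "\<dots> = lconv D t f (rconv D t G g) x y"
    by (simp only: lconv_def rconv_def tsum_pull)
  finally show ?thesis .
qed

lemma lconv_counit: "lconv D t (\<lambda>x y. counit D x * counit D y) G x y = G x y"
proof -
  have "lconv D t (\<lambda>x y. counit D x * counit D y) G x y = (\<Sum>(x1, x2)\<leftarrow>comul D x. t (counit D x1)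
      (\<Sum>(y1, y2)\<leftarrow>comul D y. t (counit D y1) (G x2 y2)))"
    by (simp only: lconv_def tsum_pull)
  also have "\<dots> = (\<Sum>(x1, x2)\<leftarrow>comul D x. t (counit D x1) (G x2 y))"
    by (intro tsum_cong' arg_cong[where f="t u" for u] k_coalgebra_counit_left[OF D] linear_intros)
  also have "\<dots> = G x y"
    by (intro k_coalgebra_counit_left[OF D] linear_intros)
  finally show ?thesis .
qed

lemma rconv_counit: "rconv D t G (\<lambda>x y. counit D x * counit D y) x y = G x y"
proof -
  have "rconv D t G (\<lambda>x y. counit D x * counit D y) x y = (\<Sum>(x1, x2)\<leftarrow>comul D x. t (counit D x2)
      (\<Sum>(y1, y2)\<leftarrow>comul D y. t (counit D y2) (G x1 y1)))"
    by (simp only: rconv_def tsum_pull)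
  also have "\<dots> = (\<Sum>(x1, x2)\<leftarrow>comul D x. t (counit D x2) (G x1 y))"
    by (intro tsum_cong' arg_cong[where f="t u" for u] k_coalgebra_counit_right[OF D] linear_intros)
  also have "\<dots> = G x y"
    by (intro k_coalgebra_counit_right[OF D] linear_intros)
  finally show ?thesis .
qed

text \<open>The instances of interest are \<open>m a x = a x\<close> and \<open>m a x = x a\<close>.\<close>

context
  fixes m :: "'d \<Rightarrow> 'd \<Rightarrow> 'd" and act :: "'d \<Rightarrow> 'x \<Rightarrow> 'x" and a :: 'd and l :: "('d \<times> 'd) list"
  assumes m: "bilinear_map (scl D) (scl D) (scl D) m"
    and comul_m: "\<And>x h. bilinear_map (scl D) (scl D) t h \<Longrightarrow>
      (\<Sum>(z1, z2)\<leftarrow>comul D (m a x). h z1 z2) =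
      (\<Sum>(a1, a2)\<leftarrow>comul D a. \<Sum>(x1, x2)\<leftarrow>comul D x. h (m a1 x1) (m a2 x2))"
    and act: "bilinear_map (scl D) t t act"
    and l: "tensor2_eq (scl D) (scl D) (comul D a) l"
begin

lemma comul_m_sum:
  assumes h: "\<And>w. linear_on (scl D) t (\<lambda>v. h v w)" "\<And>v. linear_on (scl D) t (\<lambda>w. h v w)"
  shows "(\<Sum>(z1, z2)\<leftarrow>comul D (m a x). h z1 z2) =
    (\<Sum>(a1, a2)\<leftarrow>l. \<Sum>(x1, x2)\<leftarrow>comul D x. h (m a1 x1) (m a2 x2))"
proof -
  note [linear_intros] = bilinear_map_left[OF m] bilinear_map_right[OF m]
    bilinear_map_left[OF bilinear_mapI[where f=h, OF h]] bilinear_map_right[OF bilinear_mapI[where f=h, OF h]]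
  have "(\<Sum>(z1, z2)\<leftarrow>comul D (m a x). h z1 z2) =
    (\<Sum>(a1, a2)\<leftarrow>comul D a. \<Sum>(x1, x2)\<leftarrow>comul D x. h (m a1 x1) (m a2 x2))"
    by (rule comul_m[OF bilinear_mapI[where f=h, OF h]])
  also have "\<dots> = (\<Sum>(a1, a2)\<leftarrow>l. \<Sum>(x1, x2)\<leftarrow>comul D x. h (m a1 x1) (m a2 x2))"
    by (rule tensor2_eq_sum[OF l, where t=t]) (intro linear_intros)+
  finally show ?thesis .
qed

text \<open>The form turns the first leg of a into a counit, the second leg leaves G through
  \<open>act\<close>, and the counit axiom reassembles a. The linearity hypotheses concern only
  entries of the chosen representative \<open>l\<close>: for a generator of D these lie in a
  subalgebra over which linearity is available, which need not hold for all elements of D.\<close>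

lemma lconv_module:
  assumes "\<And>a1 a2 x y. (a1, a2) \<in> set l \<Longrightarrow> f (m a1 x) y = counit D a1 * f x y"
    and "\<And>a1 a2 x y. (a1, a2) \<in> set l \<Longrightarrow> G (m a2 x) y = act a2 (G x y)"
  shows "lconv D t f G (m a x) y = act a (lconv D t f G x y)"
proof -
  note [linear_intros] = bilinear_map_left[OF act] bilinear_map_right[OF act]
  have "lconv D t f G (m a x) y = (\<Sum>(a1, a2)\<leftarrow>l. \<Sum>(x1, x2)\<leftarrow>comul D x. \<Sum>(y1, y2)\<leftarrow>comul D y.
      t (f (m a1 x1) y1) (G (m a2 x2) y2))"
    unfolding lconv_def by (intro comul_m_sum linear_intros)
  also have "\<dots> = (\<Sum>(a1, a2)\<leftarrow>l. \<Sum>(x1, x2)\<leftarrow>comul D x. \<Sum>(y1, y2)\<leftarrow>comul D y.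
      t (counit D a1 * f x1 y1) (act a2 (G x2 y2)))"
    by (intro tsum_cong) (auto simp: assms)
  also have "\<dots> = (\<Sum>(a1, a2)\<leftarrow>l. t (counit D a1) (act a2 (lconv D t f G x y)))"
    by (simp only: lconv_def tsum_pull bilinear_map_pull[OF act])
  also have "\<dots> = (\<Sum>(a1, a2)\<leftarrow>comul D a. t (counit D a1) (act a2 (lconv D t f G x y)))"
    by (rule tensor2_eq_sum[OF l, where t=t, symmetric]) (intro linear_intros)+
  also have "\<dots> = act a (lconv D t f G x y)"
    by (intro k_coalgebra_counit_left[OF D] linear_intros)
  finally show ?thesis .
qed

lemma rconv_module:
  assumes "\<And>a1 a2 x y. (a1, a2) \<in> set l \<Longrightarrow> f (m a2 x) y = counit D a2 * f x y"
    and "\<And>a1 a2 x y. (a1, a2) \<in> set l \<Longrightarrow> G (m a1 x) y = act a1 (G x y)"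
  shows "rconv D t G f (m a x) y = act a (rconv D t G f x y)"
proof -
  note [linear_intros] = bilinear_map_left[OF act] bilinear_map_right[OF act]
  have "rconv D t G f (m a x) y = (\<Sum>(a1, a2)\<leftarrow>l. \<Sum>(x1, x2)\<leftarrow>comul D x. \<Sum>(y1, y2)\<leftarrow>comul D y.
      t (f (m a2 x2) y2) (G (m a1 x1) y1))"
    unfolding rconv_def by (intro comul_m_sum linear_intros)
  also have "\<dots> = (\<Sum>(a1, a2)\<leftarrow>l. \<Sum>(x1, x2)\<leftarrow>comul D x. \<Sum>(y1, y2)\<leftarrow>comul D y.
      t (counit D a2 * f x2 y2) (act a1 (G x1 y1)))"
    by (intro tsum_cong) (auto simp: assms)
  also have "\<dots> = (\<Sum>(a1, a2)\<leftarrow>l. t (counit D a2) (act a1 (rconv D t G f x y)))"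
    by (simp only: rconv_def tsum_pull bilinear_map_pull[OF act])
  also have "\<dots> = (\<Sum>(a1, a2)\<leftarrow>comul D a. t (counit D a2) (act a1 (rconv D t G f x y)))"
    by (rule tensor2_eq_sum[OF l, where t=t, symmetric]) (intro linear_intros)+
  also have "\<dots> = act a (rconv D t G f x y)"
    by (intro k_coalgebra_counit_right[OF D] linear_intros)
  finally show ?thesis .
qed

end

end

section \<open>Bosonized algebras\<close>

text \<open>The record scheme of \<open>A\<close> admits both the Hopf algebra Drin and the plain
  algebra Heis, so everything in this locale is proved once and used for both.\<close>

locale bosonized = quasitriangular H R + B: braided_hopf H R B actB + C: braided_hopf H R C actC
  for H :: "('k::field, 'h::ab_group_add) hopf_data" and R
    and C :: "('k, 'c::ab_group_add) hopf_data" and actC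
    and B :: "('k, 'b::ab_group_add) hopf_data" and actB +
  fixes A :: "('k, 'd::ab_group_add, 'm) alg_data_scheme" and \<tau> :: "'c \<Rightarrow> 'h \<Rightarrow> 'b \<Rightarrow> 'd"
  assumes bosonized: "bosonized_algebra H C actC B actB A \<tau>"
begin

abbreviation "inC c \<equiv> \<tau> c (one H) (one B)"
abbreviation "inH h \<equiv> \<tau> (one C) h (one B)"
abbreviation "inB b \<equiv> \<tau> (one C) (one H) b"

lemma A_algebra: "k_algebra A"
  and tensor_product: "is_tensor_product3 (scl C) (scl H) (scl B) (scl A) \<tau>"
  and one_A: "one A = \<tau> (one C) (one H) (one B)"
  and tau_eq: "\<tau> c h b = inC c \<cdot>\<^bsub>A\<^esub> inH h \<cdot>\<^bsub>A\<^esub> inB b"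
  and inC_inC: "inC c \<cdot>\<^bsub>A\<^esub> inC c' = inC (c \<cdot>\<^bsub>C\<^esub> c')"
  and inH_inH: "inH h \<cdot>\<^bsub>A\<^esub> inH h' = inH (h \<cdot>\<^bsub>H\<^esub> h')"
  and inB_inB: "inB b \<cdot>\<^bsub>A\<^esub> inB b' = inB (b' \<cdot>\<^bsub>B\<^esub> b)"
  and inH_inC: "inH h \<cdot>\<^bsub>A\<^esub> inC c = (\<Sum>(h1, h2)\<leftarrow>comul H h. inC (actC h1 c) \<cdot>\<^bsub>A\<^esub> inH h2)"
  and inH_inB: "inH h \<cdot>\<^bsub>A\<^esub> inB b = (\<Sum>(h1, h2)\<leftarrow>comul H h. inB (actB h2 b) \<cdot>\<^bsub>A\<^esub> inH h1)"
proof -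
  note * = bosonized[unfolded bosonized_algebra_def Let_def]
  show "k_algebra A" "is_tensor_product3 (scl C) (scl H) (scl B) (scl A) \<tau>"
    "one A = \<tau> (one C) (one H) (one B)" using * by blast+
  show "\<tau> c h b = inC c \<cdot>\<^bsub>A\<^esub> inH h \<cdot>\<^bsub>A\<^esub> inB b"  "inC c \<cdot>\<^bsub>A\<^esub> inC c' = inC (c \<cdot>\<^bsub>C\<^esub> c')"
    "inH h \<cdot>\<^bsub>A\<^esub> inH h' = inH (h \<cdot>\<^bsub>H\<^esub> h')" "inB b \<cdot>\<^bsub>A\<^esub> inB b' = inB (b' \<cdot>\<^bsub>B\<^esub> b)"
    "inH h \<cdot>\<^bsub>A\<^esub> inC c = (\<Sum>(h1, h2)\<leftarrow>comul H h. inC (actC h1 c) \<cdot>\<^bsub>A\<^esub> inH h2)"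
    "inH h \<cdot>\<^bsub>A\<^esub> inB b = (\<Sum>(h1, h2)\<leftarrow>comul H h. inB (actB h2 b) \<cdot>\<^bsub>A\<^esub> inH h1)"
    using * by blast+
qed

lemmas A_vs [linear_intros] = k_algebra_vector_space[OF A_algebra]
lemmas A_mul = k_algebra_mul[OF A_algebra]
lemmas A_assoc = k_algebra_assoc[OF A_algebra]
lemmas [linear_intros] = bilinear_map_left[OF A_mul] bilinear_map_right[OF A_mul]
lemmas [tsum_pull] = bilinear_map_pull[OF A_mul] scale_pull[OF A_vs]

lemma tau_linear [linear_intros]:
  "linear_on s (scl C) f1 \<Longrightarrow> linear_on s (scl A) (\<lambda>x. \<tau> (f1 x) h b)"
  "linear_on s (scl H) f2 \<Longrightarrow> linear_on s (scl A) (\<lambda>x. \<tau> c (f2 x) b)"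
  "linear_on s (scl B) f3 \<Longrightarrow> linear_on s (scl A) (\<lambda>x. \<tau> c h (f3 x))"
  using tensor_product unfolding is_tensor_product3_def trilinear_map_def
  by (blast intro: linear_on_compose[of _ _ "\<lambda>u. \<tau> u h b"] linear_on_compose[of _ _ "\<lambda>v. \<tau> c v b"]
      linear_on_compose[of _ _ "\<tau> c h"])+

lemma tau_scale: "\<tau> (scl C a c) h b = scl A a (\<tau> c h b)" "\<tau> c (scl H a h) b = scl A a (\<tau> c h b)"
  "\<tau> c h (scl B a b) = scl A a (\<tau> c h b)"
  using tensor_product unfolding is_tensor_product3_def trilinear_map_def
  by (blast intro: linear_on_scale[of _ _ "\<lambda>u. \<tau> u h b"] linear_on_scale[of _ _ "\<lambda>v. \<tau> c v b"]
      linear_on_scale[of _ _ "\<tau> c h"])+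

lemma tau_sum:
  "\<tau> (\<Sum>(u, v)\<leftarrow>l. fc u v) h b = (\<Sum>(u, v)\<leftarrow>l. \<tau> (fc u v) h b)"
  "\<tau> c (\<Sum>(u, v)\<leftarrow>l. fh u v) b = (\<Sum>(u, v)\<leftarrow>l. \<tau> c (fh u v) b)"
  "\<tau> c h (\<Sum>(u, v)\<leftarrow>l. fb u v) = (\<Sum>(u, v)\<leftarrow>l. \<tau> c h (fb u v))"
  by (rule linear_on_sum[OF tau_linear(1)[OF linear_on_id[OF C.B_vs]]]
      linear_on_sum[OF tau_linear(2)[OF linear_on_id[OF H_vs]]]
      linear_on_sum[OF tau_linear(3)[OF linear_on_id[OF B.B_vs]]])+

section \<open>Multiplication by generators in normal order\<close>

lemma inB_inH:
  "inB b \<cdot>\<^bsub>A\<^esub> inH h = (\<Sum>(h1, h2)\<leftarrow>comul H h. inH h1 \<cdot>\<^bsub>A\<^esub> inB (actB (antipode H h2) b))"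
proof -
  have "(\<Sum>(h1, h2)\<leftarrow>comul H h. inH h1 \<cdot>\<^bsub>A\<^esub> inB (actB (antipode H h2) b)) =
    (\<Sum>(h1, h2)\<leftarrow>comul H h. \<Sum>(h11, h12)\<leftarrow>comul H h1. inB (actB (h12 \<cdot>\<^bsub>H\<^esub> antipode H h2) b) \<cdot>\<^bsub>A\<^esub> inH h11)"
    by (simp only: inH_inB B.act_act)
  also have "\<dots> = (\<Sum>(h1, h2)\<leftarrow>comul H h. \<Sum>(h21, h22)\<leftarrow>comul H h2. inB (actB (h21 \<cdot>\<^bsub>H\<^esub> antipode H h22) b) \<cdot>\<^bsub>A\<^esub> inH h1)"
    by (rule H_coassoc[where t="scl A"]) (intro linear_intros)+
  also have "\<dots> = (\<Sum>(h1, h2)\<leftarrow>comul H h. inB (actB (\<Sum>(h21, h22)\<leftarrow>comul H h2. h21 \<cdot>\<^bsub>H\<^esub> antipode H h22) b) \<cdot>\<^bsub>A\<^esub> inH h1)"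
    by (simp only: tsum_pull tau_sum)
  also have "\<dots> = (\<Sum>(h1, h2)\<leftarrow>comul H h. scl A (counit H h2) (inB b \<cdot>\<^bsub>A\<^esub> inH h1))"
    by (simp only: H_antipode tsum_pull tau_scale B.act_one)
  also have "\<dots> = inB b \<cdot>\<^bsub>A\<^esub> inH h"
    by (intro H_counit linear_intros)
  finally show ?thesis ..
qed

text \<open>This and the next three products need only the subalgebra and bosonization relations and
  never a product of B with C in that order. They are therefore given by the same formulas in Drin
  and in Heis.\<close>

lemma inC_tau: "inC c \<cdot>\<^bsub>A\<^esub> \<tau> c' h b = \<tau> (c \<cdot>\<^bsub>C\<^esub> c') h b"
  by (simp only: tau_eq[of c' h b] tau_eq[of "c \<cdot>\<^bsub>C\<^esub> c'" h b] inC_inC[symmetric] A_assoc)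

lemma tau_inB: "\<tau> c h b' \<cdot>\<^bsub>A\<^esub> inB b = \<tau> c h (b \<cdot>\<^bsub>B\<^esub> b')"
  by (simp only: tau_eq[of c h b'] tau_eq[of c h "b \<cdot>\<^bsub>B\<^esub> b'"] inB_inB[symmetric] A_assoc)

lemma inH_tau: "inH h \<cdot>\<^bsub>A\<^esub> \<tau> c h' b = (\<Sum>(h1, h2)\<leftarrow>comul H h. \<tau> (actC h1 c) (h2 \<cdot>\<^bsub>H\<^esub> h') b)"
proof -
  have "inH h \<cdot>\<^bsub>A\<^esub> \<tau> c h' b = (inH h \<cdot>\<^bsub>A\<^esub> inC c) \<cdot>\<^bsub>A\<^esub> (inH h' \<cdot>\<^bsub>A\<^esub> inB b)"
    by (simp only: tau_eq[of c h' b] A_assoc)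
  also have "\<dots> = (\<Sum>(h1, h2)\<leftarrow>comul H h. inC (actC h1 c) \<cdot>\<^bsub>A\<^esub> (inH h2 \<cdot>\<^bsub>A\<^esub> inH h') \<cdot>\<^bsub>A\<^esub> inB b)"
    by (simp only: inH_inC tsum_pull A_assoc)
  also have "\<dots> = (\<Sum>(h1, h2)\<leftarrow>comul H h. \<tau> (actC h1 c) (h2 \<cdot>\<^bsub>H\<^esub> h') b)"
    by (simp only: inH_inH tau_eq[symmetric])
  finally show ?thesis .
qed

lemma tau_inH: "\<tau> c h b \<cdot>\<^bsub>A\<^esub> inH h' = (\<Sum>(h1, h2)\<leftarrow>comul H h'. \<tau> c (h \<cdot>\<^bsub>H\<^esub> h1) (actB (antipode H h2) b))"
proof -
  have "\<tau> c h b \<cdot>\<^bsub>A\<^esub> inH h' = (inC c \<cdot>\<^bsub>A\<^esub> inH h) \<cdot>\<^bsub>A\<^esub> (inB b \<cdot>\<^bsub>A\<^esub> inH h')"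
    by (simp only: tau_eq[of c h b] A_assoc)
  also have "\<dots> = (\<Sum>(h1, h2)\<leftarrow>comul H h'. inC c \<cdot>\<^bsub>A\<^esub> (inH h \<cdot>\<^bsub>A\<^esub> inH h1) \<cdot>\<^bsub>A\<^esub> inB (actB (antipode H h2) b))"
    by (simp only: inB_inH tsum_pull A_assoc)
  also have "\<dots> = (\<Sum>(h1, h2)\<leftarrow>comul H h'. \<tau> c (h \<cdot>\<^bsub>H\<^esub> h1) (actB (antipode H h2) b))"
    by (simp only: inH_inH tau_eq[symmetric])
  finally show ?thesis .
qed

text \<open>Moving R^(2) past b by the bosonization relation puts a coproduct on it, and (id
  \<otimes> \<Delta>) R = R13 R12 resolves this into two R-matrices. The map \<open>F\<close> holds
  the place of the surrounding expression.\<close>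

lemma R_slide:
  assumes F: "bilinear_map (scl H) (scl A) t F" and t: "vector_space t"
  shows "(\<Sum>(r1, r2)\<leftarrow>R. F r1 (inH r2 \<cdot>\<^bsub>A\<^esub> inB b)) =
    (\<Sum>(r1, r2)\<leftarrow>R. \<Sum>(r1', r2')\<leftarrow>R. F (r1 \<cdot>\<^bsub>H\<^esub> r1') (inB (actB r2 b) \<cdot>\<^bsub>A\<^esub> inH r2'))"
proof -
  note [linear_intros] = bilinear_map_left[OF F] bilinear_map_right[OF F] t
  have "(\<Sum>(r1, r2)\<leftarrow>R. F r1 (inH r2 \<cdot>\<^bsub>A\<^esub> inB b)) =
    (\<Sum>(r1, r2)\<leftarrow>R. \<Sum>(r21, r22)\<leftarrow>comul H r2. F r1 (inB (actB r22 b) \<cdot>\<^bsub>A\<^esub> inH r21))"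
    by (simp only: inH_inB bilinear_map_sum_right[OF F])
  also have "\<dots> = (\<Sum>(r1, r2)\<leftarrow>R. \<Sum>(r1', r2')\<leftarrow>R. F (r1 \<cdot>\<^bsub>H\<^esub> r1') (inB (actB r2 b) \<cdot>\<^bsub>A\<^esub> inH r2'))"
    by (rule R_comul_right[where t=t]) (intro linear_intros)+
  finally show ?thesis .
qed

end

section \<open>The braided doubles\<close>

text \<open>\<open>D\<close> and \<open>E\<close> share their carrier type and the tensor map
  \<open>\<tau>\<close>. This expresses the identification of both underlying spaces with
  \<open>C \<otimes> H \<otimes> B\<close> and makes an equality of algebras meaningful.\<close>

locale doubles = quasitriangular H R + B: braided_hopf H R B actB + C: braided_hopf H R C actC
  for H :: "('k::field, 'h::ab_group_add) hopf_data" and R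
    and C :: "('k, 'c::ab_group_add) hopf_data" and actC
    and B :: "('k, 'b::ab_group_add) hopf_data" and actB +
  fixes ev :: "'c \<Rightarrow> 'b \<Rightarrow> 'k"
    and D :: "('k, 'd::ab_group_add) hopf_data" and E :: "('k, 'd) alg_data"
    and \<tau> :: "'c \<Rightarrow> 'h \<Rightarrow> 'b \<Rightarrow> 'd"
  assumes dual: "dually_paired H R C actC B actB ev"
    and Drin: "is_Drin H R C actC B actB ev D \<tau>"
    and Heis: "is_Heis H R C actC B actB ev E \<tau>"
begin

sublocale D: bosonized H R C actC B actB D \<tau>
  using Drin by unfold_locales (simp add: is_Drin_def Let_def)

sublocale E: bosonized H R C actC B actB E \<tau>
  using Heis by unfold_locales (simp add: is_Heis_def Let_def)

sublocale DH: hopf D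
  using Drin by unfold_locales (simp add: is_Drin_def Let_def)

abbreviation "inC c \<equiv> \<tau> c (one H) (one B)"
abbreviation "inH h \<equiv> \<tau> (one C) h (one B)"
abbreviation "inB b \<equiv> \<tau> (one C) (one H) b"

section \<open>Invariance of the evaluation pairing\<close>

lemma ev_bilinear: "bilinear_map (scl C) (scl B) (*) ev"
  and bij_C: "bij (antipode C)" and bij_B: "bij (antipode B)"
  and ev_act: "(\<Sum>(h1, h2)\<leftarrow>comul H h. ev (actC h1 c) (actB h2 b)) = counit H h * ev c b"
  and ev_mul: "ev c (b \<cdot>\<^bsub>B\<^esub> b') = (\<Sum>(c1, c2)\<leftarrow>comul C c. ev c2 b * ev c1 b')"
  and ev_unit: "ev c (one B) = counit C c"
  and ev_antipode: "ev (antipode C c) b = ev c (antipode B b)"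
  using dual unfolding dually_paired_def by blast+

lemmas [linear_intros] = bilinear_map_left[OF ev_bilinear] bilinear_map_right[OF ev_bilinear]
lemmas [tsum_pull] = bilinear_map_pull[OF ev_bilinear]

lemma ev_inv_antipode: "ev (inv (antipode C) c) b = ev c (inv (antipode B) b)"
  using ev_antipode[of "inv (antipode C) c" "inv (antipode B) b"]
  by (simp add: B.inv_antipode[OF bij_B] C.inv_antipode[OF bij_C])

lemma inv_antipode_act: "inv (antipode B) (actB h b) = actB h (inv (antipode B) b)"
  by (rule injD[OF bij_is_inj[OF bij_B]]) (simp add: B.inv_antipode[OF bij_B] B.antipode_act)

text \<open>Invariance of \<open>ev\<close> in adjoint form. Insert \<epsilon>(h2) 1 = h21 S(h22) in
  the second argument, regroup by coassociativity, and let invariance absorb the pair h11,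
  h12.\<close>

lemma ev_act_antipode: "ev c (actB (antipode H h) b) = ev (actC h c) b"
proof -
  have "ev (actC h c) b = (\<Sum>(h1, h2)\<leftarrow>comul H h. counit H h2 * ev (actC h1 c) b)"
    by (intro H_counit(2)[symmetric] linear_intros)
  also have "\<dots> = (\<Sum>(h1, h2)\<leftarrow>comul H h. ev (actC h1 c) (actB (scl H (counit H h2) (one H)) b))"
    by (simp add: bilinear_map_scale_left[OF B.act_bilinear] bilinear_map_scale_right[OF ev_bilinear])
  also have "\<dots> = (\<Sum>(h1, h2)\<leftarrow>comul H h. \<Sum>(h21, h22)\<leftarrow>comul H h2.
      ev (actC h1 c) (actB h21 (actB (antipode H h22) b)))"
    by (simp only: H_antipode(2)[symmetric] tsum_pull B.act_act)
  also have "\<dots> = (\<Sum>(h1, h2)\<leftarrow>comul H h. \<Sum>(h11, h12)\<leftarrow>comul H h1.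
      ev (actC h11 c) (actB h12 (actB (antipode H h2) b)))"
    by (rule H_coassoc[where t="(*)", symmetric]) (intro linear_intros)+
  also have "\<dots> = (\<Sum>(h1, h2)\<leftarrow>comul H h. counit H h1 * ev c (actB (antipode H h2) b))"
    by (simp only: ev_act)
  also have "\<dots> = ev c (actB (antipode H h) b)"
    by (intro H_counit(1) linear_intros)
  finally show ?thesis ..
qed

section \<open>Structure common to both doubles\<close>

lemma scl_eq: "scl E = scl D"
proof (intro ext)
  fix a x
  obtain s where s: "x = (\<Sum>(u, v, w)\<leftarrow>s. \<tau> u v w)"
    using D.tensor_product unfolding is_tensor_product3_def by meson
  have "linear_on (scl D) (scl D) (scl D a)" "linear_on (scl E) (scl E) (scl E a)"
    by (intro linear_intros)+
  then show "scl E a x = scl D a x"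
    unfolding s by (simp only: linear_on_sum3 D.tau_scale(1)[symmetric] E.tau_scale(1)[symmetric])
qed

lemma one_eq: "one E = one D"
  by (simp add: D.one_A E.one_A)

lemmas E_mul = E.A_mul[unfolded scl_eq]

text \<open>Here and in the next three lemmas both products have the same value on every
  \<open>\<tau> c h b\<close>, and these span. Thus Drin and Heis can be told apart only by the
  products of B with C.\<close>

lemma mul_inC: "inC c \<cdot>\<^bsub>E\<^esub> x = inC c \<cdot>\<^bsub>D\<^esub> x"
proof (rule tensor_product3_ext[OF D.tensor_product, where f="mul E (inC c)" and g="mul D (inC c)" and sY="scl D"])
  show "linear_on (scl D) (scl D) (mul E (inC c))" 
    by (intro bilinear_map_right[OF E_mul] linear_intros)
qed (intro linear_intros, simp only: D.inC_tau E.inC_tau)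

lemma mul_inH: "inH h \<cdot>\<^bsub>E\<^esub> x = inH h \<cdot>\<^bsub>D\<^esub> x"
proof (rule tensor_product3_ext[OF D.tensor_product, where f="mul E (inH h)" and g="mul D (inH h)" and sY="scl D"])
  show "linear_on (scl D) (scl D) (mul E (inH h))" 
    by (intro bilinear_map_right[OF E_mul] linear_intros)
qed (intro linear_intros, simp only: D.inH_tau E.inH_tau)

lemma mul_right_inB: "x \<cdot>\<^bsub>E\<^esub> inB b = x \<cdot>\<^bsub>D\<^esub> inB b"
proof (rule tensor_product3_ext[OF D.tensor_product, where f="\<lambda>x. x \<cdot>\<^bsub>E\<^esub> inB b" and g="\<lambda>x. x \<cdot>\<^bsub>D\<^esub> inB b" and sY="scl D"])
  show "linear_on (scl D) (scl D) (\<lambda>x. x \<cdot>\<^bsub>E\<^esub> inB b)" 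
    by (intro bilinear_map_left[OF E_mul] linear_intros)
qed (intro linear_intros, simp only: D.tau_inB E.tau_inB)

lemma mul_right_inH: "x \<cdot>\<^bsub>E\<^esub> inH h = x \<cdot>\<^bsub>D\<^esub> inH h"
proof (rule tensor_product3_ext[OF D.tensor_product, where f="\<lambda>x. x \<cdot>\<^bsub>E\<^esub> inH h" and g="\<lambda>x. x \<cdot>\<^bsub>D\<^esub> inH h" and sY="scl D"])
  show "linear_on (scl D) (scl D) (\<lambda>x. x \<cdot>\<^bsub>E\<^esub> inH h)" 
    by (intro bilinear_map_left[OF E_mul] linear_intros)
qed (intro linear_intros, simp only: D.tau_inH E.tau_inH)

section \<open>Projections onto B and C\<close>

definition projB :: "'d \<Rightarrow> 'b" where
  "projB = (SOME p. linear_on (scl D) (scl B) p \<and> (\<forall>c h b. p (\<tau> c h b) = scl B (counit C c * counit H h) b))"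

definition projC :: "'d \<Rightarrow> 'c" where
  "projC = (SOME p. linear_on (scl D) (scl C) p \<and> (\<forall>c h b. p (\<tau> c h b) = scl C (counit H h * counit B b) c))"

text \<open>The map \<epsilon> \<otimes> \<epsilon> \<otimes> id is trilinear, so the universal
  property of \<open>C \<otimes> H \<otimes> B\<close> supplies a linear map with these values and
  justifies the choice.\<close>

lemma projB: "linear_on (scl D) (scl B) projB" "projB (\<tau> c h b) = scl B (counit C c * counit H h) b"
proof -
  have "trilinear_map (scl C) (scl H) (scl B) (scl B) (\<lambda>c h b. scl B (counit C c * counit H h) b)"
    unfolding trilinear_map_def by (intro conjI allI linear_intros)
  then have "\<exists>p. linear_on (scl D) (scl B) p \<and> (\<forall>c h b. p (\<tau> c h b) = scl B (counit C c * counit H h) b)"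
    using tensor_product3_lift[OF D.tensor_product] by metis
  from someI_ex[OF this] show "linear_on (scl D) (scl B) projB" 
    "projB (\<tau> c h b) = scl B (counit C c * counit H h) b" by (auto simp: projB_def)
qed

lemma projC: "linear_on (scl D) (scl C) projC" "projC (\<tau> c h b) = scl C (counit H h * counit B b) c"
proof -
  have "trilinear_map (scl C) (scl H) (scl B) (scl C) (\<lambda>c h b. scl C (counit H h * counit B b) c)"
    unfolding trilinear_map_def by (intro conjI allI linear_intros)
  then have "\<exists>p. linear_on (scl D) (scl C) p \<and> (\<forall>c h b. p (\<tau> c h b) = scl C (counit H h * counit B b) c)"
    using tensor_product3_lift[OF D.tensor_product] by metis
  from someI_ex[OF this] show "linear_on (scl D) (scl C) projC" 
    "projC (\<tau> c h b) = scl C (counit H h * counit B b) c" by (auto simp: projC_def)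
qed

lemma projB_linear [linear_intros]: "linear_on s (scl D) f \<Longrightarrow> linear_on s (scl B) (\<lambda>x. projB (f x))"
  by (rule linear_on_compose[OF projB(1)])

lemma projC_linear [linear_intros]: "linear_on s (scl D) f \<Longrightarrow> linear_on s (scl C) (\<lambda>x. projC (f x))"
  by (rule linear_on_compose[OF projC(1)])

lemma counit_sum: "(\<Sum>(h1, h2)\<leftarrow>comul H h. counit H h1 * counit H h2) = counit H h"
  by (intro H_counit(1)[where t="(*)"] linear_intros)

lemma scl_sum_left:
  assumes "vector_space s"
  shows "(\<Sum>(u, v)\<leftarrow>l. s (f u v) x) = s (\<Sum>(u, v)\<leftarrow>l. f u v) x"
  by (rule bilinear_map_sum_left[OF bilinear_map_scale[OF assms], symmetric])

text \<open>Under \<open>projB\<close> left factors from C and H survive only as counits, and under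
  \<open>projC\<close> right factors from B and H do. These rules make forms built from the two
  projections linear on the outer sides.\<close>

lemma projB_inC: "projB (inC c \<cdot>\<^bsub>D\<^esub> x) = scl B (counit C c) (projB x)"
  by (rule tensor_product3_ext[OF D.tensor_product, where f="\<lambda>x. projB (inC c \<cdot>\<^bsub>D\<^esub> x)" and
        g="\<lambda>x. scl B (counit C c) (projB x)" and sY="scl B"])
    (intro linear_intros | simp only: D.inC_tau projB C.counit_B tsum_pull mult.assoc)+

lemma projB_inH: "projB (inH h \<cdot>\<^bsub>D\<^esub> x) = scl B (counit H h) (projB x)"
proof (rule tensor_product3_ext[OF D.tensor_product, where f="\<lambda>x. projB (inH h \<cdot>\<^bsub>D\<^esub> x)" and
        g="\<lambda>x. scl B (counit H h) (projB x)" and sY="scl B"])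
  fix c h' b
  have "projB (inH h \<cdot>\<^bsub>D\<^esub> \<tau> c h' b) = 
      (\<Sum>(h1, h2)\<leftarrow>comul H h. scl B ((counit H h1 * counit H h2) * (counit C c * counit H h')) b)"
    by (simp add: D.inH_tau linear_on_sum[OF projB(1)] projB C.counit_act ac_simps)
  also have "\<dots> = scl B (counit H h * (counit C c * counit H h')) b"
    by (simp only: scl_sum_left[OF B.B_vs] bilinear_map_sum_left[OF bilinear_map_times, symmetric] counit_sum)
  finally show "projB (inH h \<cdot>\<^bsub>D\<^esub> \<tau> c h' b) = scl B (counit H h) (projB (\<tau> c h' b))"
    by (simp add: projB vs_assoc[OF B.B_vs])
qed (intro linear_intros)+

lemma projC_inB: "projC (x \<cdot>\<^bsub>D\<^esub> inB b) = scl C (counit B b) (projC x)"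
  by (rule tensor_product3_ext[OF D.tensor_product, where f="\<lambda>x. projC (x \<cdot>\<^bsub>D\<^esub> inB b)" and
        g="\<lambda>x. scl C (counit B b) (projC x)" and sY="scl C"])
    (intro linear_intros | simp add: D.tau_inB projC tsum_pull ac_simps)+

lemma projC_inH: "projC (x \<cdot>\<^bsub>D\<^esub> inH h) = scl C (counit H h) (projC x)"
proof (rule tensor_product3_ext[OF D.tensor_product, where f="\<lambda>x. projC (x \<cdot>\<^bsub>D\<^esub> inH h)" and
        g="\<lambda>x. scl C (counit H h) (projC x)" and sY="scl C"])
  fix c h' b
  have "projC (\<tau> c h' b \<cdot>\<^bsub>D\<^esub> inH h) = 
      (\<Sum>(h1, h2)\<leftarrow>comul H h. scl C ((counit H h1 * counit H h2) * (counit H h' * counit B b)) c)"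
    by (simp add: D.tau_inH linear_on_sum[OF projC(1)] projC B.counit_act counit_antipode ac_simps)
  also have "\<dots> = scl C (counit H h * (counit H h' * counit B b)) c"
    by (simp only: scl_sum_left[OF C.B_vs] bilinear_map_sum_left[OF bilinear_map_times, symmetric] counit_sum)
  finally show "projC (\<tau> c h' b \<cdot>\<^bsub>D\<^esub> inH h) = scl C (counit H h) (projC (\<tau> c h' b))"
    by (simp add: projC vs_assoc[OF C.B_vs])
qed (intro linear_intros)+

lemma projB_inB: "projB (inB b) = b"
  by (simp add: projB vs_one[OF B.B_vs])

lemma projC_inC: "projC (inC c) = c"
  by (simp add: projC vs_one[OF C.B_vs])

text \<open>The product has to be brought into normal order first, and this creates the antipode.
  With R^(1) in place of h it later yields (S \<otimes> id) R.\<close>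

lemma projB_inB_inH: "projB (inB b \<cdot>\<^bsub>D\<^esub> inH h) = actB (antipode H h) b"
proof -
  have "projB (inB b \<cdot>\<^bsub>D\<^esub> inH h) = (\<Sum>(h1, h2)\<leftarrow>comul H h. scl B (counit H h1) (actB (antipode H h2) b))"
    by (simp add: D.inB_inH linear_on_sum[OF projB(1)] projB_inH projB_inB)
  also have "\<dots> = actB (antipode H h) b"
    by (intro H_counit(1) linear_intros)
  finally show ?thesis .
qed

section \<open>Coproducts of generators and one-sided linearity\<close>

lemma D_coalgebra: "k_coalgebra D"
  by (rule DH.H_parts)

lemma counit_D: "counit D (inC c) = counit C c" "counit D (inH h) = counit H h" "counit D (inB b) = counit B b"
  using Drin by (simp_all add: is_Drin_def Let_def)

lemma comul_inC: "tensor2_eq (scl D) (scl D) (comul D (inC c))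
    [(inC c1 \<cdot>\<^bsub>D\<^esub> inH r2, inC (actC r1 c2)). (c1, c2) \<leftarrow> comul C c, (r1, r2) \<leftarrow> R]"
  and comul_inH: "tensor2_eq (scl D) (scl D) (comul D (inH h)) [(inH h1, inH h2). (h1, h2) \<leftarrow> comul H h]"
  and comul_inB: "tensor2_eq (scl D) (scl D) (comul D (inB b))
    [(inB (actB r2 b1), inB b2 \<cdot>\<^bsub>D\<^esub> inH r1). (b1, b2) \<leftarrow> comul B b, (r1, r2) \<leftarrow> R]"
  using Drin by (simp_all add: is_Drin_def Let_def)

text \<open>Linearity is demanded over C and H only; products and forms alike satisfy this. The
  action is \<open>mul D\<close> for maps into D and \<open>triv\<close> for scalar forms.
  \<open>right_lin\<close> is the counterpart over H and B, with right multiplication as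
  action.\<close>

definition left_lin :: "('d \<Rightarrow> 'x \<Rightarrow> 'x) \<Rightarrow> ('d \<Rightarrow> 'd \<Rightarrow> 'x) \<Rightarrow> bool" where
  "left_lin act G \<longleftrightarrow> (\<forall>c x y. G (inC c \<cdot>\<^bsub>D\<^esub> x) y = act (inC c) (G x y)) \<and>
     (\<forall>h x y. G (inH h \<cdot>\<^bsub>D\<^esub> x) y = act (inH h) (G x y))"

definition right_lin :: "('d \<Rightarrow> 'x \<Rightarrow> 'x) \<Rightarrow> ('d \<Rightarrow> 'd \<Rightarrow> 'x) \<Rightarrow> bool" where
  "right_lin act G \<longleftrightarrow> (\<forall>b x y. G x (y \<cdot>\<^bsub>D\<^esub> inB b) = act (inB b) (G x y)) \<and>
     (\<forall>h x y. G x (y \<cdot>\<^bsub>D\<^esub> inH h) = act (inH h) (G x y))"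

abbreviation "triv \<equiv> (\<lambda>a v. counit D a * v)"

lemma triv_bilinear: "bilinear_map (scl D) (*) (*) triv"
  by (intro bilinear_mapI linear_intros)

lemma
  assumes "bilinear_map (scl D) (scl D) t f"
  shows comul_mul_left: "(\<Sum>(z1, z2)\<leftarrow>comul D (a \<cdot>\<^bsub>D\<^esub> x). f z1 z2) =
      (\<Sum>(a1, a2)\<leftarrow>comul D a. \<Sum>(x1, x2)\<leftarrow>comul D x. f (a1 \<cdot>\<^bsub>D\<^esub> x1) (a2 \<cdot>\<^bsub>D\<^esub> x2))"
    and comul_mul_right: "(\<Sum>(z1, z2)\<leftarrow>comul D (x \<cdot>\<^bsub>D\<^esub> a). f z1 z2) =
      (\<Sum>(a1, a2)\<leftarrow>comul D a. \<Sum>(x1, x2)\<leftarrow>comul D x. f (x1 \<cdot>\<^bsub>D\<^esub> a1) (x2 \<cdot>\<^bsub>D\<^esub> a2))"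
  using assms tsum_swap[of _ "comul D a" "comul D x"]
  by (simp_all add: bilinear_map_def DH.comul_mul[where t=t])

context
  fixes t :: "'k \<Rightarrow> 'x::ab_group_add \<Rightarrow> 'x" and G :: "'d \<Rightarrow> 'd \<Rightarrow> 'x" and f :: "'d \<Rightarrow> 'd \<Rightarrow> 'k"
    and act :: "'d \<Rightarrow> 'x \<Rightarrow> 'x"
  assumes t: "vector_space t" and G: "bilinear_map (scl D) (scl D) t G"
    and f: "bilinear_map (scl D) (scl D) (*) f" and act: "bilinear_map (scl D) t t act"
begin

interpretation P: coalgebra_pairings D t G f f
  using D_coalgebra t G f f by (rule coalgebra_pairings.intro)

text \<open>The same data with exchanged arguments, from which the right-handed statements are
  obtained.\<close>

interpretation Pf: coalgebra_pairings D t "\<lambda>x y. G y x" "\<lambda>x y. f y x" "\<lambda>x y. f y x"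
  using D_coalgebra t bilinear_map_flip[OF G] bilinear_map_flip[OF f] bilinear_map_flip[OF f]
  by (rule coalgebra_pairings.intro)

text \<open>The listed coproducts of elements of C and H have both legs in products of C and H. So
  \<open>lconv_module\<close> and \<open>rconv_module\<close> apply with the known linearity of
  \<open>G\<close> and \<open>f\<close>.\<close>

lemma left_lin_conv:
  assumes mult: "\<And>a b v. act (a \<cdot>\<^bsub>D\<^esub> b) v = act a (act b v)"
    and lG: "left_lin act G" and lf: "left_lin triv f"
  shows "left_lin act (lconv D t f G)" "left_lin act (rconv D t G f)"
proof -
  note [simp] = lG[unfolded left_lin_def, THEN conjunct1, rule_format]
    lG[unfolded left_lin_def, THEN conjunct2, rule_format]
    lf[unfolded left_lin_def, THEN conjunct1, rule_format]
    lf[unfolded left_lin_def, THEN conjunct2, rule_format]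
    D.A_assoc mult
  show "left_lin act (lconv D t f G)" unfolding left_lin_def
    by (intro conjI allI P.lconv_module[OF D.A_mul comul_mul_left act comul_inC]
      P.lconv_module[OF D.A_mul comul_mul_left act comul_inH]) auto
  show "left_lin act (rconv D t G f)" unfolding left_lin_def
    by (intro conjI allI P.rconv_module[OF D.A_mul comul_mul_left act comul_inC]
      P.rconv_module[OF D.A_mul comul_mul_left act comul_inH]) auto
qed

lemma right_lin_conv:
  assumes mult: "\<And>a b v. act (a \<cdot>\<^bsub>D\<^esub> b) v = act b (act a v)"
    and lG: "right_lin act G" and lf: "right_lin triv f"
  shows "right_lin act (lconv D t f G)" "right_lin act (rconv D t G f)"
proof -
  note [simp] = lG[unfolded right_lin_def, THEN conjunct1, rule_format]
    lG[unfolded right_lin_def, THEN conjunct2, rule_format]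
    lf[unfolded right_lin_def, THEN conjunct1, rule_format]
    lf[unfolded right_lin_def, THEN conjunct2, rule_format]
    D.A_assoc[symmetric] mult
  note m = bilinear_map_flip[OF D.A_mul]
  show "right_lin act (lconv D t f G)" unfolding right_lin_def lconv_flip[of D t f G]
    by (intro conjI allI Pf.lconv_module[OF m comul_mul_right act comul_inB]
      Pf.lconv_module[OF m comul_mul_right act comul_inH]) auto
  show "right_lin act (rconv D t G f)" unfolding right_lin_def rconv_flip[of D t G f]
    by (intro conjI allI Pf.rconv_module[OF m comul_mul_right act comul_inB]
      Pf.rconv_module[OF m comul_mul_right act comul_inH]) auto
qed

end

text \<open>In G(chb, c'h'b') left linearity strips c and h, right linearity strips b' and h', and
  only G(b, c') remains.\<close>

lemma left_right_lin_ext: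
  assumes G: "bilinear_map (scl D) (scl D) t G" "left_lin a G" "right_lin a' G"
    and G': "bilinear_map (scl D) (scl D) t G'" "left_lin a G'" "right_lin a' G'"
    and eq: "\<And>b c. G (inB b) (inC c) = G' (inB b) (inC c)"
  shows "G x y = G' x y"
proof (rule tensor_product3_ext[OF D.tensor_product, where f="\<lambda>x. G x y" and g="\<lambda>x. G' x y" and sY=t])
  fix c h b
  show "G (\<tau> c h b) y = G' (\<tau> c h b) y"
  proof (rule tensor_product3_ext[OF D.tensor_product, where f="G (\<tau> c h b)" and g="G' (\<tau> c h b)" and sY=t])
    fix c' h' b'
    show "G (\<tau> c h b) (\<tau> c' h' b') = G' (\<tau> c h b) (\<tau> c' h' b')"
      using G(2,3) G'(2,3)
      by (simp only: D.tau_eq[of c' h' b'] left_lin_def right_lin_def D.tau_eq[of c h b] 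
          D.A_assoc[of "inC c" "inH h" "inB b"] eq)
  qed (intro bilinear_map_right[OF G(1)] bilinear_map_right[OF G'(1)] linear_intros)+
qed (intro bilinear_map_left[OF G(1)] bilinear_map_left[OF G'(1)] linear_intros)+

section \<open>The extended forms \<omega> and \<sigma> and their convolution inverses\<close>

definition ext_pairing :: "('c \<Rightarrow> 'b \<Rightarrow> 'k) \<Rightarrow> 'd \<Rightarrow> 'd \<Rightarrow> 'k" where
  "ext_pairing \<phi> x y = \<phi> (projC y) (projB x)"

abbreviation "ev' \<equiv> \<lambda>c b. ev (inv (antipode C) c) b"

lemma ev'_bilinear: "bilinear_map (scl C) (scl B) (*) ev'"
  by (intro bilinear_mapI linear_intros linear_on_compose[OF _ C.inv_antipode_linear[OF bij_C]])

context
  fixes \<phi> :: "'c \<Rightarrow> 'b \<Rightarrow> 'k"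
  assumes \<phi>: "bilinear_map (scl C) (scl B) (*) \<phi>"
begin

lemma ext_pairing_bilinear: "bilinear_map (scl D) (scl D) (*) (ext_pairing \<phi>)"
  unfolding ext_pairing_def
  by (intro bilinear_mapI bilinear_map_left[OF \<phi>] bilinear_map_right[OF \<phi>] linear_intros)

lemma ext_pairing_left: "left_lin triv (ext_pairing \<phi>)"
  by (simp add: left_lin_def ext_pairing_def projB_inC projB_inH counit_D bilinear_map_pull[OF \<phi>])

lemma ext_pairing_right: "right_lin triv (ext_pairing \<phi>)"
  by (simp add: right_lin_def ext_pairing_def projC_inB projC_inH counit_D bilinear_map_pull[OF \<phi>])

lemma ext_pairing_inB_inC: "ext_pairing \<phi> (inB b) (inC c) = \<phi> c b"
  by (simp add: ext_pairing_def projB_inB projC_inC)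

lemma ext_pairing_inB_inH_inC: "ext_pairing \<phi> (inB b \<cdot>\<^bsub>D\<^esub> inH h) (inC c) = \<phi> c (actB (antipode H h) b)"
  by (simp add: ext_pairing_def projB_inB_inH projC_inC)

end

lemma triv_lin_right_inH: "right_lin triv f \<Longrightarrow> f x (y \<cdot>\<^bsub>D\<^esub> inH h) = counit H h * f x y"
  by (simp add: right_lin_def counit_D)

lemma comul_inB_inC_sum:
  assumes F: "\<And>x2 y1 y2. linear_on (scl D) t (\<lambda>x1. F x1 x2 y1 y2)" "\<And>x1 y1 y2. linear_on (scl D) t (\<lambda>x2. F x1 x2 y1 y2)"
    "\<And>x1 x2 y2. linear_on (scl D) t (\<lambda>y1. F x1 x2 y1 y2)" "\<And>x1 x2 y1. linear_on (scl D) t (\<lambda>y2. F x1 x2 y1 y2)"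
  shows "(\<Sum>(x1, x2)\<leftarrow>comul D (inB b). \<Sum>(y1, y2)\<leftarrow>comul D (inC c). F x1 x2 y1 y2) =
    (\<Sum>(b1, b2)\<leftarrow>comul B b. \<Sum>(c1, c2)\<leftarrow>comul C c. \<Sum>(r1, r2)\<leftarrow>R. \<Sum>(r1', r2')\<leftarrow>R.
      F (inB (actB r2 b1)) (inB b2 \<cdot>\<^bsub>D\<^esub> inH r1) (inC c1 \<cdot>\<^bsub>D\<^esub> inH r2') (inC (actC r1' c2)))"
proof -
  note [linear_intros] = linear_on_vs2[OF F(1)] F
  have "(\<Sum>(x1, x2)\<leftarrow>comul D (inB b). \<Sum>(y1, y2)\<leftarrow>comul D (inC c). F x1 x2 y1 y2) =
    (\<Sum>(x1, x2)\<leftarrow>[(inB (actB r2 b1), inB b2 \<cdot>\<^bsub>D\<^esub> inH r1). (b1, b2) \<leftarrow> comul B b, (r1, r2) \<leftarrow> R].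
       \<Sum>(y1, y2)\<leftarrow>comul D (inC c). F x1 x2 y1 y2)"
    by (rule tensor2_eq_sum[OF comul_inB, where t=t]) (intro linear_intros)+
  also have "\<dots> = (\<Sum>(x1, x2)\<leftarrow>[(inB (actB r2 b1), inB b2 \<cdot>\<^bsub>D\<^esub> inH r1). (b1, b2) \<leftarrow> comul B b, (r1, r2) \<leftarrow> R].
       \<Sum>(y1, y2)\<leftarrow>[(inC c1 \<cdot>\<^bsub>D\<^esub> inH r2, inC (actC r1 c2)). (c1, c2) \<leftarrow> comul C c, (r1, r2) \<leftarrow> R]. F x1 x2 y1 y2)"
    by (rule tsum_cong', rule tensor2_eq_sum[OF comul_inC, where t=t]) (intro linear_intros)+
  also have "\<dots> = (\<Sum>(b1, b2)\<leftarrow>comul B b. \<Sum>(r1, r2)\<leftarrow>R. \<Sum>(c1, c2)\<leftarrow>comul C c. \<Sum>(r1', r2')\<leftarrow>R.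
      F (inB (actB r2 b1)) (inB b2 \<cdot>\<^bsub>D\<^esub> inH r1) (inC c1 \<cdot>\<^bsub>D\<^esub> inH r2') (inC (actC r1' c2)))"
    by (simp add: tensor_comprehension)
  also have "\<dots> = (\<Sum>(b1, b2)\<leftarrow>comul B b. \<Sum>(c1, c2)\<leftarrow>comul C c. \<Sum>(r1, r2)\<leftarrow>R. \<Sum>(r1', r2')\<leftarrow>R.
      F (inB (actB r2 b1)) (inB b2 \<cdot>\<^bsub>D\<^esub> inH r1) (inC c1 \<cdot>\<^bsub>D\<^esub> inH r2') (inC (actC r1' c2)))"
    by (rule tsum_cong', rule tsum_swap)
  finally show ?thesis .
qed

text \<open>Of the two R-matrices in the coproducts of b and c, the one from c has its second leg
  standing to the right in an argument of \<open>f\<close>. There it becomes a counit, and the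
  counit identity of R removes it.\<close>

lemma lconv_inB_inC:
  assumes t: "vector_space t" and f: "bilinear_map (scl D) (scl D) (*) f" "right_lin triv f"
    and G: "bilinear_map (scl D) (scl D) t G"
  shows "lconv D t f G (inB b) (inC c) =
    (\<Sum>(b1, b2)\<leftarrow>comul B b. \<Sum>(c1, c2)\<leftarrow>comul C c. \<Sum>(r1, r2)\<leftarrow>R.
      t (f (inB (actB r2 b1)) (inC c1)) (G (inB b2 \<cdot>\<^bsub>D\<^esub> inH r1) (inC c2)))"
proof -
  note [linear_intros] = t bilinear_map_left[OF f(1)] bilinear_map_right[OF f(1)]
     bilinear_map_left[OF G(1)] bilinear_map_right[OF G(1)]
  have "lconv D t f G (inB b) (inC c) =
    (\<Sum>(b1, b2)\<leftarrow>comul B b. \<Sum>(c1, c2)\<leftarrow>comul C c. \<Sum>(r1, r2)\<leftarrow>R. \<Sum>(r1', r2')\<leftarrow>R.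
      t (f (inB (actB r2 b1)) (inC c1 \<cdot>\<^bsub>D\<^esub> inH r2')) (G (inB b2 \<cdot>\<^bsub>D\<^esub> inH r1) (inC (actC r1' c2))))"
    unfolding lconv_def by (rule comul_inB_inC_sum[where t=t]) (intro linear_intros)+
  also have "\<dots> = (\<Sum>(b1, b2)\<leftarrow>comul B b. \<Sum>(c1, c2)\<leftarrow>comul C c. \<Sum>(r1, r2)\<leftarrow>R. \<Sum>(r1', r2')\<leftarrow>R.
      t (counit H r2') (t (f (inB (actB r2 b1)) (inC c1)) (G (inB b2 \<cdot>\<^bsub>D\<^esub> inH r1) (inC (actC r1' c2)))))"
    by (simp only: triv_lin_right_inH[OF f(2)] vs_assoc[OF t])
  also have "\<dots> = (\<Sum>(b1, b2)\<leftarrow>comul B b. \<Sum>(c1, c2)\<leftarrow>comul C c. \<Sum>(r1, r2)\<leftarrow>R.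
      t (f (inB (actB r2 b1)) (inC c1)) (G (inB b2 \<cdot>\<^bsub>D\<^esub> inH r1) (inC (actC (one H) c2))))"
    by (rule tsum_cong', rule tsum_cong', rule tsum_cong', rule R_counit_right) (intro linear_intros)
  finally show ?thesis by simp
qed

text \<open>The antipode stems from the factor R^(1) to the right of b2. The sum over the coproduct
  of c is placed innermost so that \<open>ev_mul\<close> can contract it.\<close>

lemma ext_pairing_conv:
  assumes \<phi>: "bilinear_map (scl C) (scl B) (*) \<phi>" and \<psi>: "bilinear_map (scl C) (scl B) (*) \<psi>"
  shows "lconv D (*) (ext_pairing \<phi>) (ext_pairing \<psi>) (inB b) (inC c) =
    (\<Sum>(b1, b2)\<leftarrow>comul B b. \<Sum>(r1, r2)\<leftarrow>R. \<Sum>(c1, c2)\<leftarrow>comul C c.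
      \<phi> c1 (actB r2 b1) * \<psi> c2 (actB (antipode H r1) b2))"
  unfolding lconv_inB_inC[OF vector_space_field ext_pairing_bilinear[OF \<phi>] ext_pairing_right[OF \<phi>]
      ext_pairing_bilinear[OF \<psi>]] ext_pairing_inB_inC[OF \<phi>] ext_pairing_inB_inH_inC[OF \<psi>]
  by (rule tsum_cong', rule tsum_swap)

abbreviation "\<omega> \<equiv> ext_pairing ev"
abbreviation "\<sigma> \<equiv> ext_pairing ev'"
abbreviation "triv2 \<equiv> (\<lambda>x y. counit D x * counit D y)"

lemma triv2: "bilinear_map (scl D) (scl D) (*) triv2" "left_lin triv triv2" "right_lin triv triv2"
  by (intro bilinear_mapI linear_intros) (simp_all add: left_lin_def right_lin_def)

text \<open>Both sides are linear over the outer subalgebras for the trivial action, so an inverse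
  need only be checked on B and C.\<close>

lemma conv_eq_triv2:
  assumes \<phi>: "bilinear_map (scl C) (scl B) (*) \<phi>" and \<psi>: "bilinear_map (scl C) (scl B) (*) \<psi>"
    and eq: "\<And>b c. (\<Sum>(b1, b2)\<leftarrow>comul B b. \<Sum>(r1, r2)\<leftarrow>R. \<Sum>(c1, c2)\<leftarrow>comul C c.
      \<phi> c1 (actB r2 b1) * \<psi> c2 (actB (antipode H r1) b2)) = counit B b * counit C c"
  shows "lconv D (*) (ext_pairing \<phi>) (ext_pairing \<psi>) = triv2"
proof (rule ext, rule ext, rule left_right_lin_ext[OF _ _ _ triv2])
  note p = ext_pairing_bilinear[OF \<phi>] ext_pairing_bilinear[OF \<psi>]
  interpret P: coalgebra_pairings D "(*)" "ext_pairing \<psi>" "ext_pairing \<phi>" "ext_pairing \<phi>"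
    using D_coalgebra vector_space_field p(2,1,1) by (rule coalgebra_pairings.intro)
  show "bilinear_map (scl D) (scl D) (*) (lconv D (*) (ext_pairing \<phi>) (ext_pairing \<psi>))"
    by (rule P.lconv_bilinear)
  show "left_lin triv (lconv D (*) (ext_pairing \<phi>) (ext_pairing \<psi>))"
    by (rule left_lin_conv[OF vector_space_field p(2,1) triv_bilinear _ ext_pairing_left[OF \<psi>] ext_pairing_left[OF \<phi>]]) simp
  show "right_lin triv (lconv D (*) (ext_pairing \<phi>) (ext_pairing \<psi>))"
    by (rule right_lin_conv[OF vector_space_field p(2,1) triv_bilinear _ ext_pairing_right[OF \<psi>] ext_pairing_right[OF \<phi>]]) simp
  show "lconv D (*) (ext_pairing \<phi>) (ext_pairing \<psi>) (inB b) (inC c) = triv2 (inB b) (inC c)" for b c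
    by (simp add: ext_pairing_conv[OF \<phi> \<psi>] eq counit_D)
qed

text \<open>The inverse antipode is carried from C to B, where it commutes with the action of H.
  Then \<open>ev_mul\<close> collects everything into the pairing of c with the element computed in
  \<open>braided_inverse_left\<close>.\<close>

lemma omega_sigma: "lconv D (*) \<omega> \<sigma> = triv2"
proof (rule conv_eq_triv2[OF ev_bilinear ev'_bilinear])
  fix b c
  have "(\<Sum>(b1, b2)\<leftarrow>comul B b. \<Sum>(r1, r2)\<leftarrow>R. \<Sum>(c1, c2)\<leftarrow>comul C c.
      ev c1 (actB r2 b1) * ev' c2 (actB (antipode H r1) b2)) =
    ev c (\<Sum>(b1, b2)\<leftarrow>comul B b. \<Sum>(r1, r2)\<leftarrow>R. actB (antipode H r1) (inv (antipode B) b2) \<cdot>\<^bsub>B\<^esub> actB r2 b1)"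
    by (simp only: ev_inv_antipode inv_antipode_act tsum_pull ev_mul mult.commute)
  also have "\<dots> = counit B b * counit C c"
    by (simp only: B.braided_inverse_left[OF bij_B] tsum_pull ev_unit)
  finally show "(\<Sum>(b1, b2)\<leftarrow>comul B b. \<Sum>(r1, r2)\<leftarrow>R. \<Sum>(c1, c2)\<leftarrow>comul C c.
      ev c1 (actB r2 b1) * ev' c2 (actB (antipode H r1) b2)) = counit B b * counit C c" .
qed

lemma sigma_omega: "lconv D (*) \<sigma> \<omega> = triv2"
proof (rule conv_eq_triv2[OF ev'_bilinear ev_bilinear])
  fix b c
  have "(\<Sum>(b1, b2)\<leftarrow>comul B b. \<Sum>(r1, r2)\<leftarrow>R. \<Sum>(c1, c2)\<leftarrow>comul C c.
      ev' c1 (actB r2 b1) * ev c2 (actB (antipode H r1) b2)) =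
    ev c (\<Sum>(b1, b2)\<leftarrow>comul B b. \<Sum>(r1, r2)\<leftarrow>R. actB (antipode H r1) b2 \<cdot>\<^bsub>B\<^esub> actB r2 (inv (antipode B) b1))"
    by (simp only: ev_inv_antipode inv_antipode_act tsum_pull ev_mul mult.commute)
  also have "\<dots> = counit B b * counit C c"
    by (simp only: B.braided_inverse_right[OF bij_B] tsum_pull ev_unit)
  finally show "(\<Sum>(b1, b2)\<leftarrow>comul B b. \<Sum>(r1, r2)\<leftarrow>R. \<Sum>(c1, c2)\<leftarrow>comul C c.
      ev' c1 (actB r2 b1) * ev c2 (actB (antipode H r1) b2)) = counit B b * counit C c" .
qed

section \<open>Comparison of the two products\<close>

lemma lin_mul_D: "left_lin (mul D) (mul D)" "right_lin (\<lambda>a x. x \<cdot>\<^bsub>D\<^esub> a) (mul D)"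
  by (simp_all add: left_lin_def right_lin_def D.A_assoc)

text \<open>The actions are taken from D and not from E; this is legitimate because both products
  agree for these factors. It makes \<open>mul E\<close> and \<open>mul D\<close> comparable by
  \<open>left_right_lin_ext\<close>.\<close>

lemma lin_mul_E: "left_lin (mul D) (mul E)" "right_lin (\<lambda>a x. x \<cdot>\<^bsub>D\<^esub> a) (mul E)"
  by (simp_all add: left_lin_def right_lin_def mul_inC[symmetric] mul_inH[symmetric]
    mul_right_inB[symmetric] mul_right_inH[symmetric] E.A_assoc)

lemmas \<omega> = ext_pairing_bilinear[OF ev_bilinear] ext_pairing_left[OF ev_bilinear] ext_pairing_right[OF ev_bilinear]
lemmas \<sigma> = ext_pairing_bilinear[OF ev'_bilinear]

abbreviation "\<Lambda> \<equiv> lconv D (scl D) \<omega> (mul E)"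

text \<open>This is the cross relation of Heis: its right side is the convolution action of \<omega>
  on the product, evaluated at b and c. The product of c and b on the other side is the same in both
  algebras.\<close>

lemma Lambda_inB_inC: "\<Lambda> (inB b) (inC c) = inC c \<cdot>\<^bsub>D\<^esub> inB b"
proof -
  have "inC c \<cdot>\<^bsub>E\<^esub> inB b = (\<Sum>(b1, b2)\<leftarrow>comul B b. \<Sum>(c1, c2)\<leftarrow>comul C c. \<Sum>(r1, r2)\<leftarrow>R.
      scl E (ev c1 (actB r2 b1)) (inB b2 \<cdot>\<^bsub>E\<^esub> inH r1 \<cdot>\<^bsub>E\<^esub> inC c2))"
    using Heis by (simp only: is_Heis_def Let_def)
  then show ?thesis
    by (simp only: lconv_inB_inC[OF D.A_vs \<omega>(1,3) E_mul] ext_pairing_inB_inC[OF ev_bilinear]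
        mul_right_inH mul_right_inB scl_eq)
qed

lemma omega_mul_D_inB_inC: "lconv D (scl D) \<omega> (mul D) (inB b) (inC c) =
    (\<Sum>(b1, b2)\<leftarrow>comul B b. \<Sum>(c1, c2)\<leftarrow>comul C c. \<Sum>(r1, r2)\<leftarrow>R.
       scl D (ev (actC r1 c2) b2) (inC c1 \<cdot>\<^bsub>D\<^esub> inH r2 \<cdot>\<^bsub>D\<^esub> inB b1))"
  unfolding lconv_inB_inC[OF D.A_vs \<omega>(1,3) D.A_mul] ext_pairing_inB_inC[OF ev_bilinear]
  using Drin by (simp only: is_Drin_def Let_def)

interpretation L: coalgebra_pairings D "scl D" "mul E" \<omega> \<omega>
  using D_coalgebra D.A_vs E_mul \<omega>(1) \<omega>(1) by (rule coalgebra_pairings.intro)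

interpretation L2: coalgebra_pairings D "scl D" \<Lambda> \<omega> \<omega>
  using D_coalgebra D.A_vs L.lconv_bilinear \<omega>(1) \<omega>(1) by (rule coalgebra_pairings.intro)

interpretation M: coalgebra_pairings D "scl D" "mul D" \<omega> \<omega>
  using D_coalgebra D.A_vs D.A_mul \<omega>(1) \<omega>(1) by (rule coalgebra_pairings.intro)

lemma lin_Lambda: "left_lin (mul D) \<Lambda>" "right_lin (\<lambda>a x. x \<cdot>\<^bsub>D\<^esub> a) \<Lambda>"
  using left_lin_conv(1)[OF D.A_vs E_mul \<omega>(1) D.A_mul D.A_assoc lin_mul_E(1) \<omega>(2)]
    right_lin_conv(1)[OF D.A_vs E_mul \<omega>(1) bilinear_map_flip[OF D.A_mul] D.A_assoc[symmetric] lin_mul_E(2) \<omega>(3)]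
  by simp_all

text \<open>Expanding both coproducts gives two R-matrices. Right linearity of
  \<open>\<Lambda>\<close> yields c1 (r2 b1) r2', and \<open>ev_act_antipode\<close> turns the form
  into the pairing of r1 r1' c2 with b2, where juxtaposition also denotes the action. This is the
  right side of the Drin relation after \<open>slide\<close>.\<close>

lemma Lambda_omega_inB_inC:
  "rconv D (scl D) \<Lambda> \<omega> (inB b) (inC c) = lconv D (scl D) \<omega> (mul D) (inB b) (inC c)"
proof -
  note [linear_intros] = bilinear_map_left[OF \<omega>(1)] bilinear_map_right[OF \<omega>(1)]
     bilinear_map_left[OF L.lconv_bilinear] bilinear_map_right[OF L.lconv_bilinear]
  \<comment> \<open>\<open>R_slide\<close> for the map that sends h and x to the pairing of h c2
    with b2 times the product of c1 and x.\<close>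
  have slide: "(\<Sum>(r1, r2)\<leftarrow>R. scl D (ev (actC r1 c2) b2) (inC c1 \<cdot>\<^bsub>D\<^esub> (inH r2 \<cdot>\<^bsub>D\<^esub> inB b1))) =
     (\<Sum>(r1, r2)\<leftarrow>R. \<Sum>(r1', r2')\<leftarrow>R. scl D (ev (actC (r1 \<cdot>\<^bsub>H\<^esub> r1') c2) b2)
       (inC c1 \<cdot>\<^bsub>D\<^esub> (inB (actB r2 b1) \<cdot>\<^bsub>D\<^esub> inH r2')))" for b1 b2 c1 c2
    by (rule D.R_slide[OF bilinear_mapI D.A_vs]) (intro linear_intros)+
  have "rconv D (scl D) \<Lambda> \<omega> (inB b) (inC c) =
    (\<Sum>(b1, b2)\<leftarrow>comul B b. \<Sum>(c1, c2)\<leftarrow>comul C c. \<Sum>(r1, r2)\<leftarrow>R. \<Sum>(r1', r2')\<leftarrow>R.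
      scl D (\<omega> (inB b2 \<cdot>\<^bsub>D\<^esub> inH r1) (inC (actC r1' c2))) (\<Lambda> (inB (actB r2 b1)) (inC c1 \<cdot>\<^bsub>D\<^esub> inH r2')))"
    unfolding rconv_def by (rule comul_inB_inC_sum[where t="scl D"]) (intro linear_intros)+
  also have "\<dots> = (\<Sum>(b1, b2)\<leftarrow>comul B b. \<Sum>(c1, c2)\<leftarrow>comul C c. \<Sum>(r1, r2)\<leftarrow>R. \<Sum>(r1', r2')\<leftarrow>R.
      scl D (ev (actC (r1 \<cdot>\<^bsub>H\<^esub> r1') c2) b2) (inC c1 \<cdot>\<^bsub>D\<^esub> (inB (actB r2 b1) \<cdot>\<^bsub>D\<^esub> inH r2')))"
    using lin_Lambda(2)
    by (simp add: right_lin_def Lambda_inB_inC ext_pairing_inB_inH_inC[OF ev_bilinear] ev_act_antipode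
        C.act_act D.A_assoc)
  also have "\<dots> = lconv D (scl D) \<omega> (mul D) (inB b) (inC c)"
    unfolding omega_mul_D_inB_inC D.A_assoc slide ..
  finally show ?thesis .
qed

lemma Lambda_omega: "rconv D (scl D) \<Lambda> \<omega> = lconv D (scl D) \<omega> (mul D)"
proof (rule ext, rule ext, rule left_right_lin_ext[where a="mul D" and a'="\<lambda>a x. x \<cdot>\<^bsub>D\<^esub> a" and t="scl D"
      and G="rconv D (scl D) \<Lambda> \<omega>" and G'="lconv D (scl D) \<omega> (mul D)"])
  show "bilinear_map (scl D) (scl D) (scl D) (rconv D (scl D) \<Lambda> \<omega>)"
    by (rule L2.rconv_bilinear)
  show "left_lin (mul D) (rconv D (scl D) \<Lambda> \<omega>)"
    using left_lin_conv(2)[OF D.A_vs L.lconv_bilinear \<omega>(1) D.A_mul D.A_assoc lin_Lambda(1) \<omega>(2)] by simp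
  show "right_lin (\<lambda>a x. x \<cdot>\<^bsub>D\<^esub> a) (rconv D (scl D) \<Lambda> \<omega>)"
    using right_lin_conv(2)[OF D.A_vs L.lconv_bilinear \<omega>(1) bilinear_map_flip[OF D.A_mul]
        D.A_assoc[symmetric] lin_Lambda(2) \<omega>(3)] by simp
  show "bilinear_map (scl D) (scl D) (scl D) (lconv D (scl D) \<omega> (mul D))"
    by (rule M.lconv_bilinear)
  show "left_lin (mul D) (lconv D (scl D) \<omega> (mul D))"
    using left_lin_conv(1)[OF D.A_vs D.A_mul \<omega>(1) D.A_mul D.A_assoc lin_mul_D(1) \<omega>(2)] by simp
  show "right_lin (\<lambda>a x. x \<cdot>\<^bsub>D\<^esub> a) (lconv D (scl D) \<omega> (mul D))"
    using right_lin_conv(1)[OF D.A_vs D.A_mul \<omega>(1) bilinear_map_flip[OF D.A_mul]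
        D.A_assoc[symmetric] lin_mul_D(2) \<omega>(3)] by simp
qed (rule Lambda_omega_inB_inC)

lemma mul_D_eq: "mul D = rconv D (scl D) (mul E) \<omega>"
proof (intro ext)
  fix x y
  interpret S: coalgebra_pairings D "scl D" "mul D" \<sigma> \<omega>
    using D_coalgebra D.A_vs D.A_mul \<sigma> \<omega>(1) by (rule coalgebra_pairings.intro)
  interpret T: coalgebra_pairings D "scl D" "rconv D (scl D) (mul E) \<omega>" \<sigma> \<omega>
    using D_coalgebra D.A_vs L.rconv_bilinear \<sigma> \<omega>(1) by (rule coalgebra_pairings.intro)
  have "lconv D (scl D) \<omega> (mul D) = lconv D (scl D) \<omega> (rconv D (scl D) (mul E) \<omega>)"
    by (intro ext) (simp only: Lambda_omega[symmetric] L.lconv_rconv)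
  \<comment> \<open>Acting with \<sigma> from the left cancels \<omega>, since
    \<open>sigma_omega\<close> makes their product the unit form.\<close>
  then have "lconv D (scl D) \<sigma> (lconv D (scl D) \<omega> (mul D)) x y =
      lconv D (scl D) \<sigma> (lconv D (scl D) \<omega> (rconv D (scl D) (mul E) \<omega>)) x y"
    by simp
  then show "x \<cdot>\<^bsub>D\<^esub> y = rconv D (scl D) (mul E) \<omega> x y"
    by (simp only: S.lconv_lconv T.lconv_lconv sigma_omega S.lconv_counit T.lconv_counit)
qed

text \<open>Successive right actions by \<omega> and then \<sigma> combine to the action of their
  product in this order, so here the other one-sided inverse, \<open>omega_sigma\<close>, is
  required.\<close>

lemma twisted_mul_D: "rconv D (scl D) (mul D) \<sigma> = mul E"
proof (intro ext)
  fix x y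
  interpret S: coalgebra_pairings D "scl D" "mul E" \<omega> \<sigma>
    using D_coalgebra D.A_vs E_mul \<omega>(1) \<sigma> by (rule coalgebra_pairings.intro)
  show "rconv D (scl D) (mul D) \<sigma> x y = x \<cdot>\<^bsub>E\<^esub> y"
    by (simp only: mul_D_eq S.rconv_rconv omega_sigma S.rconv_counit)
qed

lemma Heis_eq_twist: "E = cocycle_twist D \<sigma>"
  using twisted_mul_D
  by (intro alg_data.equality) (simp_all add: cocycle_twist_def scl_eq one_eq rconv_def fun_eq_iff)

lemma sigma_tau:
  "\<sigma> (\<tau> c h b) (\<tau> c' h' b') = counit C c * counit H h * ev (inv (antipode C) c') b * counit H h' * counit B b'"
  by (simp add: ext_pairing_def projB projC bilinear_map_pull[OF ev'_bilinear] ac_simps)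

text \<open>The twisted product is that of Heis, so associativity and the unit laws come from there
  and no cocycle identity has to be computed.\<close>

lemma right_2cocycle_sigma: "right_2cocycle D \<sigma>"
  using E.A_algebra \<sigma> by (simp add: right_2cocycle_def Heis_eq_twist[symmetric])

end

theorem corollary3p8p5:
  fixes H :: "('k::field, 'h::ab_group_add) hopf_data" and R :: "('h \<times> 'h) list"
    and C :: "('k, 'c::ab_group_add) hopf_data" and actC :: "'h \<Rightarrow> 'c \<Rightarrow> 'c"
    and B :: "('k, 'b::ab_group_add) hopf_data" and actB :: "'h \<Rightarrow> 'b \<Rightarrow> 'b"
    and ev :: "'c \<Rightarrow> 'b \<Rightarrow> 'k"
    and Drin :: "('k, 'd::ab_group_add) hopf_data" and Heis :: "('k, 'd) alg_data"
    and \<tau> :: "'c \<Rightarrow> 'h \<Rightarrow> 'b \<Rightarrow> 'd"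
  assumes "quasitriangular_hopf_algebra H R"
    and "dually_paired H R C actC B actB ev"
    and "is_Drin H R C actC B actB ev Drin \<tau>"
    and "is_Heis H R C actC B actB ev Heis \<tau>"
  shows "\<exists>\<sigma>. right_2cocycle Drin \<sigma> \<and>
             (\<forall>c h b c' h' b'. \<sigma> (\<tau> c h b) (\<tau> c' h' b') =
                counit C c * counit H h * ev (inv (antipode C) c') b * counit H h' * counit B b') \<and>
             Heis = cocycle_twist Drin \<sigma>"
proof -
  interpret doubles H R C actC B actB ev Drin Heis \<tau>
    using assms by unfold_locales (simp_all add: dually_paired_def)
  show ?thesis
    using right_2cocycle_sigma sigma_tau Heis_eq_twist by blast
qed

end
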